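(* Let $A$ be a finite involutively closed alphabet and let $\Gamma^{(1)},\ldots,\Gamma^{(k)}$ be complete context-free $A$-graphs. There is an algorithm which, for a given element $g\in\mathcal{G}(\Gamma^{(1)}\sqcup\cdots\sqcup\Gamma^{(k)})$ (represented by a word over $A$), checks whether the order $o(g)$ is finite or not. In other words, the torsion problem is solvable for groups in $\mathbf{CF\text{-}TR}$.
   Context: Let $A$ be a finite alphabet closed under a formal inversion $a\mapsto a^{-1}$ ($a^{-1}\ne a$, $(a^{-1})^{-1}=a$), $A^*$ the free monoid on $A$, and $F_A$ the free group whose elements are the reduced words over $A$. An $A$-graph is a connected directed graph $\Gamma$ with vertex set $V(\Gamma)$, edges labeled by letters of $A$, and a fixed-point-free involution $e\mapsto e^{-1}$ on edges which exchanges initial and terminal vertices and inverts labels, and which is deterministic: for each vertex $v$ and each $a\in A$ there is at most one edge labeled $a$ starting at $v$. It is complete if for each $v$ and $a$ there is at least one such edge. $L(\Gamma,x)\subseteq A^*$ is the set of labels of circuits at the vertex $x$ (walks from $x$ to $x$). $\Gamma$ is context-free if $L(\Gamma,x_0)$ is a context-free language for some (equivalently, every) vertex $x_0$. For complete $A$-graphs $\Gamma^{(1)},\ldots,\Gamma^{(k)}$ the transition group $\mathcal{G}(\Gamma^{(1)}\sqcup\cdots\sqcup\Gamma^{(k)})$ is the quotient of $F_A$ by the normal subgroup defined by $\bigcap_{i}\bigcap_{p\in V(\Gamma^{(i)})}L(\Gamma^{(i)},p)$; equivalently, it is the group of permutations of the disjoint union of the sets $V(\Gamma^{(i)})$ generated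 by the permutations induced by the letters of $A$. $\mathbf{CF\text{-}TR}$ is the class of all groups isomorphic to such a transition group for some finite involutively closed $A$ and some finite collection of complete context-free $A$-graphs. *)

theory Defs
  imports
    "HOL-Algebra.Multiplicative_Group"
    "HOL-Algebra.Generated_Groups"
    "HOL-Library.Nat_Bijection"
    "Graph_Theory.Arc_Walk"
    "Graph_Theory.Digraph_Component"
begin

section \<open>Decidable sets of words\<close>

text \<open>
  Algorithms are Kleene's partial recursive functions: \<open>rec_eval f xs y\<close> says that the
  program \<open>f\<close> halts on the arguments \<open>xs\<close> with the value \<open>y\<close>.
\<close>

datatype recf =
    Zero
  | Succ
  | Proj nat
  | Comp recf "recf list"
  | PrimRec recf recf
  | Mu recf

inductive rec_eval :: "recf \<Rightarrow> nat list \<Rightarrow> nat \<Rightarrow> bool" where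
  Zero: "rec_eval Zero xs 0"
| Succ: "rec_eval Succ [x] (Suc x)"
| Proj: "i < length xs \<Longrightarrow> rec_eval (Proj i) xs (xs ! i)"
| Comp: "list_all2 (\<lambda>g y. rec_eval g xs y) gs ys \<Longrightarrow> rec_eval f ys z \<Longrightarrow>
    rec_eval (Comp f gs) xs z"
| PrimRec_0: "rec_eval f xs y \<Longrightarrow> rec_eval (PrimRec f g) (0 # xs) y"
| PrimRec_Suc: "rec_eval (PrimRec f g) (n # xs) r \<Longrightarrow> rec_eval g (n # r # xs) y \<Longrightarrow>
    rec_eval (PrimRec f g) (Suc n # xs) y"
| Mu: "rec_eval f (n # xs) 0 \<Longrightarrow> (\<And>m. m < n \<Longrightarrow> \<exists>y. rec_eval f (m # xs) (Suc y)) \<Longrightarrow>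
    rec_eval (Mu f) xs n"

lemma rec_eval_deterministic:
  assumes "rec_eval f xs y" and "rec_eval f xs z"
  shows "y = z"
  using assms
proof (induction arbitrary: z rule: rec_eval.induct)
  case (Comp xs gs ys f y)
  from Comp.prems obtain zs where zs: "list_all2 (\<lambda>g y. rec_eval g xs y) gs zs"
    and fz: "rec_eval f zs z" by (cases rule: rec_eval.cases) auto
  have "ys = zs"
    using Comp.IH(1) zs by (auto simp: list_all2_conv_all_nth intro!: nth_equalityI)
  with Comp.IH(2) fz show ?case by blast
next
  case (PrimRec_Suc f g n xs r y)
  from PrimRec_Suc.prems obtain r' where "rec_eval (PrimRec f g) (n # xs) r'"
    and "rec_eval g (n # r' # xs) z" by (cases rule: rec_eval.cases) auto
  then show ?case using PrimRec_Suc.IH by blast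
next
  case (Mu f n xs)
  from Mu.prems have "rec_eval f (z # xs) 0 \<and> (\<forall>m<z. \<exists>y. rec_eval f (m # xs) (Suc y))"
    by (cases rule: rec_eval.cases) auto
  then have z: "rec_eval f (z # xs) 0"
    and below: "\<And>m. m < z \<Longrightarrow> \<exists>y. rec_eval f (m # xs) (Suc y)"
    by blast+
  show ?case
  proof (rule linorder_cases[of n z])
    assume "n < z"
    then obtain y where "rec_eval f (n # xs) (Suc y)" using below by blast
    then show ?thesis using Mu.IH(1) by blast
  next
    assume "z < n" then show ?thesis using Mu.IH(2) z by blast
  qed simp
next
  case (PrimRec_0 f xs y g)
  from PrimRec_0.prems have "rec_eval f xs z" by (cases rule: rec_eval.cases) auto
  then show ?case by (rule PrimRec_0.IH)
next
  case (Zero xs)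
  then show ?case by (cases rule: rec_eval.cases) auto
next
  case (Succ x)
  then show ?case by (cases rule: rec_eval.cases) auto
next
  case (Proj i xs)
  from Proj.prems show ?case by (cases rule: rec_eval.cases) auto
qed

text \<open>
  Words over the finite alphabet \<open>A\<close> are presented to a program through the standard coding of
  lists of natural numbers, after numbering the letters. Two numberings of a finite set differ by
  a finite table, so quantifying universally over them is harmless.
\<close>

definition decidable_words :: "'a set \<Rightarrow> 'a list set \<Rightarrow> bool" where
  "decidable_words A L \<longleftrightarrow>
     (\<forall>code :: 'a \<Rightarrow> nat. inj_on code A \<longrightarrow>
        (\<exists>f. \<forall>w \<in> lists A. rec_eval f [list_encode (map code w)] (if w \<in> L then 1 else 0)))"


section \<open>Context-free languages\<close>

text \<open>
  A grammar is a start symbol with a set of productions; \<open>Inl\<close> marks nonterminals and \<open>Inr\<close>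
  terminals. Natural numbers suffice as nonterminals, since grammars are finite.
\<close>

type_synonym ('n, 'a) productions = "('n \<times> ('n + 'a) list) set"

inductive derives :: "('n, 'a) productions \<Rightarrow> ('n + 'a) list \<Rightarrow> ('n + 'a) list \<Rightarrow> bool"
  for P where
  "(X, rhs) \<in> P \<Longrightarrow> derives P (u @ [Inl X] @ v) (u @ rhs @ v)"

definition grammar_language :: "('n, 'a) productions \<Rightarrow> 'n \<Rightarrow> 'a list set" where
  "grammar_language P S = {w. (derives P)\<^sup>*\<^sup>* [Inl S] (map Inr w)}"

definition context_free_language :: "'a list set \<Rightarrow> bool" where
  "context_free_language L \<longleftrightarrow>
     (\<exists>(P :: (nat, 'a) productions) S. finite P \<and> L = grammar_language P S)"


section \<open>Involutive alphabets and free groups\<close>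

locale involutive_alphabet =
  fixes A :: "'a set" and iv :: "'a \<Rightarrow> 'a"
  assumes finite_A: "finite A"
    and iv_closed: "a \<in> A \<Longrightarrow> iv a \<in> A"
    and iv_neq: "a \<in> A \<Longrightarrow> iv a \<noteq> a"
    and iv_iv: "a \<in> A \<Longrightarrow> iv (iv a) = a"

definition reduced :: "('a \<Rightarrow> 'a) \<Rightarrow> 'a list \<Rightarrow> bool" where
  "reduced iv w \<longleftrightarrow> successively (\<lambda>a b. b \<noteq> iv a) w"

fun push :: "('a \<Rightarrow> 'a) \<Rightarrow> 'a \<Rightarrow> 'a list \<Rightarrow> 'a list" where
  "push iv a [] = [a]"
| "push iv a (b # w) = (if b = iv a then w else a # b # w)"

text \<open>The reduced word obtained from a word by cancelling factors \<open>a (iv a)\<close>.\<close>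

definition reduce :: "('a \<Rightarrow> 'a) \<Rightarrow> 'a list \<Rightarrow> 'a list" where
  "reduce iv w = foldr (push iv) w []"

definition free_group :: "'a set \<Rightarrow> ('a \<Rightarrow> 'a) \<Rightarrow> 'a list monoid" where
  "free_group A iv =
     \<lparr>carrier = {w \<in> lists A. reduced iv w}, monoid.mult = (\<lambda>u v. reduce iv (u @ v)), one = []\<rparr>"

definition word_inv :: "('a \<Rightarrow> 'a) \<Rightarrow> 'a list \<Rightarrow> 'a list" where
  "word_inv iv w = rev (map iv w)"

lemma foldr_append_reduce: "reduce iv (u @ v) = foldr (push iv) u (reduce iv v)"
  by (simp add: reduce_def)

lemma reduced_push: "reduced iv w \<Longrightarrow> reduced iv (push iv a w)"
  by (cases w) (auto simp: reduced_def successively_Cons)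

lemma reduced_foldr_push: "reduced iv s \<Longrightarrow> reduced iv (foldr (push iv) w s)"
  by (induction w) (auto intro: reduced_push)

lemma reduced_reduce: "reduced iv (reduce iv w)"
  unfolding reduce_def by (rule reduced_foldr_push) (simp add: reduced_def)

lemma reduce_reduced: "reduced iv w \<Longrightarrow> reduce iv w = w"
proof (induction w)
  case (Cons a w)
  then show ?case by (cases w) (auto simp: reduced_def reduce_def)
qed (simp add: reduce_def)

lemma push_closed: "a \<in> A \<Longrightarrow> w \<in> lists A \<Longrightarrow> push iv a w \<in> lists A"
  by (cases w) auto

lemma foldr_push_closed: "w \<in> lists A \<Longrightarrow> s \<in> lists A \<Longrightarrow> foldr (push iv) w s \<in> lists A"
proof (induction w)
  case (Cons a w)
  then show ?case using push_closed[of a A "foldr (push iv) w s" iv] by auto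
qed simp

lemma reduce_closed: "w \<in> lists A \<Longrightarrow> reduce iv w \<in> lists A"
  unfolding reduce_def by (rule foldr_push_closed) auto

context involutive_alphabet
begin

lemma push_push_iv:
  assumes "a \<in> A" "reduced iv w"
  shows "push iv a (push iv (iv a) w) = w"
proof (cases w)
  case (Cons b w')
  with assms show ?thesis by (cases w') (auto simp: reduced_def iv_iv)
qed simp

lemma foldr_push_push:
  assumes "a \<in> A" "reduced iv s"
  shows "foldr (push iv) (push iv a x) s = push iv a (foldr (push iv) x s)"
proof (cases x)
  case (Cons b x')
  then show ?thesis using assms by (auto simp: push_push_iv reduced_foldr_push)
qed simp

lemma foldr_push_reduce:
  assumes "x \<in> lists A" "reduced iv s"
  shows "foldr (push iv) (reduce iv x) s = foldr (push iv) x s"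
  using assms
proof (induction x)
  case (Cons a x)
  then have "reduce iv (a # x) = push iv a (reduce iv x)" by (simp add: reduce_def)
  with Cons show ?case by (simp add: foldr_push_push)
qed (simp add: reduce_def)

lemma reduce_append_reduce_left: "u \<in> lists A \<Longrightarrow> reduce iv (reduce iv u @ v) = reduce iv (u @ v)"
  by (simp add: foldr_append_reduce foldr_push_reduce reduced_reduce)

lemma reduce_append_reduce_right: "reduce iv (u @ reduce iv v) = reduce iv (u @ v)"
  by (simp add: foldr_append_reduce reduce_reduced reduced_reduce)

lemma word_inv_closed: "w \<in> lists A \<Longrightarrow> word_inv iv w \<in> lists A"
  by (auto simp: word_inv_def iv_closed)

lemma reduce_word_inv_left: "w \<in> lists A \<Longrightarrow> reduce iv (word_inv iv w @ w) = []"
proof (induction w)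
  case (Cons a w)
  then have "push iv (iv a) (push iv a (reduce iv w)) = reduce iv w"
    using push_push_iv[of "iv a" "reduce iv w"] by (simp add: iv_closed iv_iv reduced_reduce)
  with Cons show ?case by (simp add: word_inv_def foldr_append_reduce) (simp add: reduce_def)
qed (simp add: word_inv_def reduce_def)

lemma group_free_group: "group (free_group A iv)"
proof (rule groupI)
  fix x y z
  assume "x \<in> carrier (free_group A iv)" "y \<in> carrier (free_group A iv)"
    "z \<in> carrier (free_group A iv)"
  then have "x \<in> lists A" "y \<in> lists A" by (auto simp: free_group_def)
  then have "x @ y \<in> lists A" by auto
  then show "x \<otimes>\<^bsub>free_group A iv\<^esub> y \<otimes>\<^bsub>free_group A iv\<^esub> z =
      x \<otimes>\<^bsub>free_group A iv\<^esub> (y \<otimes>\<^bsub>free_group A iv\<^esub> z)"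
    by (simp add: free_group_def reduce_append_reduce_left reduce_append_reduce_right)
next
  fix x assume "x \<in> carrier (free_group A iv)"
  then have x: "x \<in> lists A" by (auto simp: free_group_def)
  show "\<exists>y\<in>carrier (free_group A iv). y \<otimes>\<^bsub>free_group A iv\<^esub> x = \<one>\<^bsub>free_group A iv\<^esub>"
  proof (rule bexI[of _ "reduce iv (word_inv iv x)"])
    show "reduce iv (word_inv iv x) \<otimes>\<^bsub>free_group A iv\<^esub> x = \<one>\<^bsub>free_group A iv\<^esub>"
      using x word_inv_closed[OF x]
      by (simp add: free_group_def reduce_append_reduce_left reduce_word_inv_left)
    show "reduce iv (word_inv iv x) \<in> carrier (free_group A iv)"
      using reduce_closed[OF word_inv_closed[OF x], of iv]
      by (simp add: free_group_def reduced_reduce)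
  qed
next
  fix x y
  assume "x \<in> carrier (free_group A iv)" "y \<in> carrier (free_group A iv)"
  then have "x @ y \<in> lists A" by (auto simp: free_group_def)
  then show "x \<otimes>\<^bsub>free_group A iv\<^esub> y \<in> carrier (free_group A iv)"
    using reduce_closed[of "x @ y" A iv] by (simp add: free_group_def reduced_reduce)
qed (auto simp: free_group_def reduce_reduced reduced_def)

end


section \<open>Graphs over an involutive alphabet\<close>

record ('v, 'e, 'a) labelled_graph =
  dgraph :: "('v, 'e) pre_digraph"
  label :: "'e \<Rightarrow> 'a"
  arc_inv :: "'e \<Rightarrow> 'e"

abbreviation vertices :: "('v, 'e, 'a) labelled_graph \<Rightarrow> 'v set" where
  "vertices \<Gamma> \<equiv> verts (dgraph \<Gamma>)"

abbreviation edges :: "('v, 'e, 'a) labelled_graph \<Rightarrow> 'e set" where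
  "edges \<Gamma> \<equiv> arcs (dgraph \<Gamma>)"

abbreviation src :: "('v, 'e, 'a) labelled_graph \<Rightarrow> 'e \<Rightarrow> 'v" where
  "src \<Gamma> \<equiv> tail (dgraph \<Gamma>)"

abbreviation tgt :: "('v, 'e, 'a) labelled_graph \<Rightarrow> 'e \<Rightarrow> 'v" where
  "tgt \<Gamma> \<equiv> head (dgraph \<Gamma>)"

locale A_graph = involutive_alphabet A iv
  for A :: "'a set" and iv :: "'a \<Rightarrow> 'a" +
  fixes \<Gamma> :: "('v, 'e, 'a) labelled_graph"
  assumes wf: "wf_digraph (dgraph \<Gamma>)"
    and connected: "Digraph_Component.connected (dgraph \<Gamma>)"
    and label_closed: "e \<in> edges \<Gamma> \<Longrightarrow> label \<Gamma> e \<in> A"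
    and arc_inv_closed: "e \<in> edges \<Gamma> \<Longrightarrow> arc_inv \<Gamma> e \<in> edges \<Gamma>"
    and arc_inv_neq: "e \<in> edges \<Gamma> \<Longrightarrow> arc_inv \<Gamma> e \<noteq> e"
    and arc_inv_arc_inv: "e \<in> edges \<Gamma> \<Longrightarrow> arc_inv \<Gamma> (arc_inv \<Gamma> e) = e"
    and src_arc_inv: "e \<in> edges \<Gamma> \<Longrightarrow> src \<Gamma> (arc_inv \<Gamma> e) = tgt \<Gamma> e"
    and tgt_arc_inv: "e \<in> edges \<Gamma> \<Longrightarrow> tgt \<Gamma> (arc_inv \<Gamma> e) = src \<Gamma> e"
    and label_arc_inv: "e \<in> edges \<Gamma> \<Longrightarrow> label \<Gamma> (arc_inv \<Gamma> e) = iv (label \<Gamma> e)"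
    and deterministic: "\<lbrakk>e \<in> edges \<Gamma>; e' \<in> edges \<Gamma>; src \<Gamma> e = src \<Gamma> e'; label \<Gamma> e = label \<Gamma> e'\<rbrakk>
      \<Longrightarrow> e = e'"

locale complete_A_graph = A_graph +
  assumes complete: "\<lbrakk>v \<in> vertices \<Gamma>; a \<in> A\<rbrakk> \<Longrightarrow> \<exists>e \<in> edges \<Gamma>. src \<Gamma> e = v \<and> label \<Gamma> e = a"

definition circuit_language :: "('v, 'e, 'a) labelled_graph \<Rightarrow> 'v \<Rightarrow> 'a list set" where
  "circuit_language \<Gamma> x = {map (label \<Gamma>) p | p. pre_digraph.awalk (dgraph \<Gamma>) x p x}"

definition context_free_graph :: "('v, 'e, 'a) labelled_graph \<Rightarrow> bool" where
  "context_free_graph \<Gamma> \<longleftrightarrow>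
     (\<exists>x\<^sub>0 \<in> vertices \<Gamma>. context_free_language (circuit_language \<Gamma> x\<^sub>0))"


section \<open>Transition groups\<close>

text \<open>
  A finite family of graphs is a list. Its members share one type of vertices, but they are treated
  as disjoint: only the words that are circuit labels at every vertex of every member matter.
\<close>

definition kernel_words ::
    "'a set \<Rightarrow> ('v, 'e, 'a) labelled_graph list \<Rightarrow> 'a list set" where
  "kernel_words A \<Gamma>s = {w \<in> lists A. \<forall>\<Gamma> \<in> set \<Gamma>s. \<forall>p \<in> vertices \<Gamma>. w \<in> circuit_language \<Gamma> p}"

definition transition_kernel ::
    "'a set \<Rightarrow> ('a \<Rightarrow> 'a) \<Rightarrow> ('v, 'e, 'a) labelled_graph list \<Rightarrow> 'a list set" where
  "transition_kernel A iv \<Gamma>s = reduce iv ` kernel_words A \<Gamma>s"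

definition transition_group ::
    "'a set \<Rightarrow> ('a \<Rightarrow> 'a) \<Rightarrow> ('v, 'e, 'a) labelled_graph list \<Rightarrow> 'a list set monoid" where
  "transition_group A iv \<Gamma>s = free_group A iv Mod transition_kernel A iv \<Gamma>s"

text \<open>The element of the transition group represented by an arbitrary word over \<open>A\<close>.\<close>

definition word_element ::
    "'a set \<Rightarrow> ('a \<Rightarrow> 'a) \<Rightarrow> ('v, 'e, 'a) labelled_graph list \<Rightarrow> 'a list \<Rightarrow> 'a list set" where
  "word_element A iv \<Gamma>s w = transition_kernel A iv \<Gamma>s #>\<^bsub>free_group A iv\<^esub> reduce iv w"

lemma (in A_graph) awalk_inv:
  assumes "pre_digraph.awalk (dgraph \<Gamma>) u p v"
  shows "pre_digraph.awalk (dgraph \<Gamma>) v (rev (map (arc_inv \<Gamma>) p)) u"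
    and "map (label \<Gamma>) (rev (map (arc_inv \<Gamma>) p)) = word_inv iv (map (label \<Gamma>) p)"
proof -
  interpret wf_digraph "dgraph \<Gamma>" by (rule wf)
  show "awalk v (rev (map (arc_inv \<Gamma>) p)) u"
    using assms
  proof (induction p arbitrary: u)
    case (Cons e p)
    then have e: "e \<in> edges \<Gamma>" "src \<Gamma> e = u" and "awalk (tgt \<Gamma> e) p v"
      by (auto simp: awalk_Cons_iff)
    then have 1: "awalk v (rev (map (arc_inv \<Gamma>) p)) (tgt \<Gamma> e)" using Cons.IH by blast
    have "arc_inv \<Gamma> e \<in> edges \<Gamma>" "src \<Gamma> (arc_inv \<Gamma> e) = tgt \<Gamma> e" "tgt \<Gamma> (arc_inv \<Gamma> e) = u"
      using e arc_inv_closed src_arc_inv tgt_arc_inv by auto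
    then have 2: "awalk (tgt \<Gamma> e) [arc_inv \<Gamma> e] u"
      using e by (auto simp: awalk_Cons_iff awalk_Nil_iff)
    from awalk_appendI[OF 1 2] show ?case by simp
  qed (auto simp: awalk_def)
  show "map (label \<Gamma>) (rev (map (arc_inv \<Gamma>) p)) = word_inv iv (map (label \<Gamma>) p)"
    using assms by (auto simp: awalk_def word_inv_def rev_map label_arc_inv)
qed

lemma (in complete_A_graph) ex_awalk:
  assumes "w \<in> lists A" "u \<in> vertices \<Gamma>"
  shows "\<exists>p v. pre_digraph.awalk (dgraph \<Gamma>) u p v \<and> map (label \<Gamma>) p = w"
proof -
  interpret wf_digraph "dgraph \<Gamma>" by (rule wf)
  show ?thesis using assms
  proof (induction w arbitrary: u)
    case Nil
    then show ?case by (intro exI[of _ "[]"] exI[of _ u]) (simp add: awalk_Nil_iff)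
  next
    case (Cons a w)
    then obtain e where e: "e \<in> edges \<Gamma>" "src \<Gamma> e = u" "label \<Gamma> e = a"
      using complete[of u a] by auto
    then have "tgt \<Gamma> e \<in> vertices \<Gamma>" by simp
    moreover note \<open>w \<in> lists A\<close>
    ultimately obtain p v where "awalk (tgt \<Gamma> e) p v" "map (label \<Gamma>) p = w"
      using Cons.IH by blast
    with e show ?case by (intro exI[of _ "e # p"] exI[of _ v]) (auto simp: awalk_Cons_iff)
  qed
qed

context complete_A_graph
begin

lemma circuit_language_Nil: "x \<in> vertices \<Gamma> \<Longrightarrow> [] \<in> circuit_language \<Gamma> x"
  by (auto simp: circuit_language_def pre_digraph.awalk_def pre_digraph.cas.simps intro!: exI[of _ "[]"])

lemma circuit_language_append:
  assumes "u \<in> circuit_language \<Gamma> x" "v \<in> circuit_language \<Gamma> x"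
  shows "u @ v \<in> circuit_language \<Gamma> x"
proof -
  interpret wf_digraph "dgraph \<Gamma>" by (rule wf)
  from assms obtain p q where "awalk x p x" "u = map (label \<Gamma>) p" "awalk x q x"
    "v = map (label \<Gamma>) q" by (auto simp: circuit_language_def)
  then show ?thesis
    unfolding circuit_language_def by (auto intro!: exI[of _ "p @ q"] awalk_appendI simp del: awalk_append_iff)
qed

lemma circuit_language_inv:
  assumes "u \<in> circuit_language \<Gamma> x"
  shows "word_inv iv u \<in> circuit_language \<Gamma> x"
proof -
  from assms obtain p where p: "pre_digraph.awalk (dgraph \<Gamma>) x p x" "u = map (label \<Gamma>) p"
    by (auto simp: circuit_language_def)
  have "word_inv iv u = map (label \<Gamma>) (rev (map (arc_inv \<Gamma>) p))"
    unfolding awalk_inv(2)[OF p(1)] p(2) ..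
  with awalk_inv(1)[OF p(1)] show ?thesis unfolding circuit_language_def by blast
qed

lemma circuit_language_conj:
  assumes "w \<in> lists A" "x \<in> vertices \<Gamma>" and "\<And>y. y \<in> vertices \<Gamma> \<Longrightarrow> u \<in> circuit_language \<Gamma> y"
  shows "w @ u @ word_inv iv w \<in> circuit_language \<Gamma> x"
proof -
  interpret wf_digraph "dgraph \<Gamma>" by (rule wf)
  obtain p y where p: "awalk x p y" "map (label \<Gamma>) p = w" using ex_awalk assms by blast
  then have "y \<in> vertices \<Gamma>" by (simp add: awalk_last_in_verts)
  from assms(3)[OF this] obtain q where q: "awalk y q y" "u = map (label \<Gamma>) q"
    by (auto simp: circuit_language_def)
  let ?r = "rev (map (arc_inv \<Gamma>) p)"
  have "awalk x (p @ q @ ?r) x"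
    by (rule awalk_appendI[OF p(1) awalk_appendI[OF q(1) awalk_inv(1)[OF p(1)]]])
  moreover have "w @ u @ word_inv iv w = map (label \<Gamma>) (p @ q @ ?r)"
    unfolding map_append awalk_inv(2)[OF p(1)] p(2) q(2) ..
  ultimately show ?thesis unfolding circuit_language_def by blast
qed

end

lemma normal_transition_kernel:
  assumes "involutive_alphabet A iv" and cpl: "\<And>\<Gamma>. \<Gamma> \<in> set \<Gamma>s \<Longrightarrow> complete_A_graph A iv \<Gamma>"
  shows "transition_kernel A iv \<Gamma>s \<lhd> free_group A iv"
proof -
  interpret involutive_alphabet A iv by fact
  let ?F = "free_group A iv" and ?N = "transition_kernel A iv \<Gamma>s" and ?K = "kernel_words A \<Gamma>s"
  interpret F: group ?F by (rule group_free_group)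
  have K: "w \<in> lists A" if "w \<in> ?K" for w using that by (simp add: kernel_words_def)
  have m: "reduce iv u \<otimes>\<^bsub>?F\<^esub> reduce iv v = reduce iv (u @ v)" if "u \<in> lists A" for u v
    using that by (simp add: free_group_def reduce_append_reduce_left reduce_append_reduce_right)
  have c: "reduce iv u \<in> carrier ?F" if "u \<in> lists A" for u
    using reduce_closed[OF that, of iv] by (simp add: free_group_def reduced_reduce)
  have i: "inv\<^bsub>?F\<^esub> reduce iv u = reduce iv (word_inv iv u)" if u: "u \<in> lists A" for u
  proof (rule F.inv_equality)
    show "reduce iv (word_inv iv u) \<otimes>\<^bsub>?F\<^esub> reduce iv u = \<one>\<^bsub>?F\<^esub>"
      using m[OF word_inv_closed[OF u]] reduce_word_inv_left[OF u] by (simp add: free_group_def)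
  qed (use u c word_inv_closed in auto)
  have Knil: "[] \<in> ?K"
    using complete_A_graph.circuit_language_Nil[OF cpl] by (auto simp: kernel_words_def)
  have Kapp: "u @ v \<in> ?K" if "u \<in> ?K" "v \<in> ?K" for u v
    using that complete_A_graph.circuit_language_append[OF cpl] by (auto simp: kernel_words_def)
  have Kinv: "word_inv iv u \<in> ?K" if "u \<in> ?K" for u
    using that complete_A_graph.circuit_language_inv[OF cpl] word_inv_closed[of u]
    unfolding kernel_words_def by blast
  have Kconj: "w @ u @ word_inv iv w \<in> ?K" if "w \<in> lists A" "u \<in> ?K" for u w
    unfolding kernel_words_def
  proof (intro CollectI conjI ballI)
    show "w @ u @ word_inv iv w \<in> lists A" using that K word_inv_closed by auto
    fix \<Gamma> p assume \<Gamma>: "\<Gamma> \<in> set \<Gamma>s" and p: "p \<in> vertices \<Gamma>"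
    show "w @ u @ word_inv iv w \<in> circuit_language \<Gamma> p"
      using that \<Gamma>
      by (intro complete_A_graph.circuit_language_conj[OF cpl[OF \<Gamma>] _ p])
        (auto simp: kernel_words_def)
  qed
  have sub: "subgroup ?N ?F"
  proof (rule F.subgroupI)
    show "?N \<subseteq> carrier ?F" using c K by (auto simp: transition_kernel_def)
    show "?N \<noteq> {}" using Knil by (auto simp: transition_kernel_def)
    show "inv\<^bsub>?F\<^esub> x \<in> ?N" if "x \<in> ?N" for x
      using that i K Kinv by (auto simp: transition_kernel_def)
    show "x \<otimes>\<^bsub>?F\<^esub> y \<in> ?N" if "x \<in> ?N" "y \<in> ?N" for x y
      using that m K Kapp by (auto simp: transition_kernel_def)
  qed
  show ?thesis
    unfolding F.normal_inv_iff
  proof (intro conjI sub ballI)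
    fix x h assume x: "x \<in> carrier ?F" and "h \<in> ?N"
    then obtain u where u: "u \<in> ?K" "h = reduce iv u" by (auto simp: transition_kernel_def)
    have xl: "x \<in> lists A" and xr: "reduce iv x = x"
      using x by (auto simp: free_group_def reduce_reduced)
    have "x \<otimes>\<^bsub>?F\<^esub> h \<otimes>\<^bsub>?F\<^esub> inv\<^bsub>?F\<^esub> x = reduce iv (x @ u @ word_inv iv x)"
      using m[OF xl, of u] m[of "x @ u" "word_inv iv x"] i[OF xl] xl K[OF u(1)] xr u(2) by auto
    then show "x \<otimes>\<^bsub>?F\<^esub> h \<otimes>\<^bsub>?F\<^esub> inv\<^bsub>?F\<^esub> x \<in> ?N"
      using Kconj[OF xl u(1)] by (auto simp: transition_kernel_def)
  qed
qed

lemma group_transition_group: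
  assumes "involutive_alphabet A iv" and "\<And>\<Gamma>. \<Gamma> \<in> set \<Gamma>s \<Longrightarrow> complete_A_graph A iv \<Gamma>"
  shows "group (transition_group A iv \<Gamma>s)"
  unfolding transition_group_def
  by (rule normal.factorgroup_is_group) (rule normal_transition_kernel[OF assms])


section \<open>The torsion problem\<close>

text \<open>In the library, \<open>group.ord G x = 0\<close> means that \<open>x\<close> has infinite order.\<close>

definition finite_order :: "('g, 'b) monoid_scheme \<Rightarrow> 'g \<Rightarrow> bool" where
  "finite_order G x \<longleftrightarrow> group.ord G x \<noteq> 0"

definition word_value :: "('g, 'b) monoid_scheme \<Rightarrow> 'g list \<Rightarrow> 'g" where
  "word_value G w = foldr (\<lambda>x y. x \<otimes>\<^bsub>G\<^esub> y) w \<one>\<^bsub>G\<^esub>"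

text \<open>
  Solvability of the torsion problem does not depend on the finite generating set through which
  elements are presented; it is required for all of them, and one has to exist.
\<close>

definition torsion_problem_solvable :: "('g, 'b) monoid_scheme \<Rightarrow> bool" where
  "torsion_problem_solvable G \<longleftrightarrow>
     (\<exists>X. finite X \<and> X \<subseteq> carrier G \<and> generate G X = carrier G) \<and>
     (\<forall>X. finite X \<and> X \<subseteq> carrier G \<and> generate G X = carrier G \<longrightarrow>
        decidable_words (X \<union> m_inv G ` X) {w. finite_order G (word_value G w)})"

end

theory Submission
  imports Defs "HOL-Library.More_List" "HOL-Library.Sublist"
begin

text \<open>
  A word \<open>w\<close> represents an element of finite order if and only if, in each of the
  graphs, some positive power of \<open>w\<close> leads every vertex back to itself. For a
  complete context-free graph three facts turn this into finitely many membership questions in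
  the context-free language of circuits at a root \<open>x\<^sub>0\<close>.

  First, there are finitely many cone types, as in the theorem of Muller and Schupp. The level
  of a vertex is its distance from the root, and the cone of a vertex consists of the words that
  can be read from it without descending below its level. A walk in the cone of \<open>f\<close>
  that comes back to the level of \<open>f\<close> becomes a circuit at the root when geodesics
  are added at both ends. A binary parse of this circuit cuts the walk at vertices that are
  close to its end points (\<open>chain_of_parse\<close>), and these end points are therefore
  close to each other (\<open>chain_of_return\<close>). What such a walk does is thus determined
  by finite data in a ball of fixed radius around \<open>f\<close>. Consequently the cone of
  \<open>f\<close>, together with the circuits at \<open>f\<close> inside it, takes only
  finitely many values (\<open>finite_cone_types\<close>).

  Secondly, finite cycles of \<open>w\<close> are short. Let \<open>f\<close> be a lowest vertex
  on a cycle. If the cycle rose more than \<open>T * length w\<close> levels above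
  \<open>f\<close>, where \<open>T\<close> is the number of cone types, then among the last
  visits to the successive levels two would agree in cone type and in the position inside
  \<open>w\<close>. The segment between them could then be repeated forever without coming down
  again, and the cycle would never close (\<open>cone_escape\<close>,
  \<open>orbit_height\<close>). So the cycle stays in a ball around \<open>f\<close>, and its
  length is at most \<open>c ^ Suc (length w)\<close> for a constant \<open>c\<close> of the
  graph. Hence \<open>w\<close> has finite order on the graph if and only if its power with
  exponent \<open>fact (c ^ Suc (length w))\<close> acts trivially.

  Thirdly, a word \<open>W\<close> acts trivially as soon as it fixes the vertices at distance
  at most \<open>R + length W\<close> from the root (\<open>trivial_in_ball\<close>): for a
  given word and a given place of the lowest vertex on the walk, the cone type of that vertex
  decides whether the walk is closed, and every cone type occurs within distance
  \<open>R\<close>.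

  Altogether \<open>w\<close> has finite order if and only if the conjugates of this power by
  all words \<open>u\<close> up to a computable length label circuits at
  \<open>x\<^sub>0\<close> (\<open>finite_order_criterion\<close>). Membership in a context-free
  language is decided by the algorithm of Cocke, Younger and Kasami
  (\<open>splitting_family_decidable\<close>), and total recursive functions on codes of lists
  are composed from closure rules. An element of another group in the isomorphism class, given
  as a product of generators, is first rewritten as a word over the alphabet by a substitution.
\<close>

section \<open>Total recursive functions on lists of numbers\<close>

definition computable :: "nat \<Rightarrow> (nat list \<Rightarrow> nat) \<Rightarrow> bool" where
  "computable n f \<longleftrightarrow> (\<exists>r. \<forall>xs. length xs = n \<longrightarrow> rec_eval r xs (f xs))"

definition computable_list :: "nat \<Rightarrow> (nat list \<Rightarrow> nat list) \<Rightarrow> bool" where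
  "computable_list n F \<longleftrightarrow> computable n (\<lambda>xs. list_encode (F xs))"

definition decidable :: "nat \<Rightarrow> (nat list \<Rightarrow> bool) \<Rightarrow> bool" where
  "decidable n P \<longleftrightarrow> computable n (\<lambda>xs. if P xs then 1 else 0)"

text \<open>
  These rules read off computability from the shape of a term, in the manner of a typing
  derivation. Variables are positions in the list of arguments; under a binder the bound values
  are put in front, so that the remaining arguments appear as \<open>drop m xs\<close>.
\<close>

named_theorems computable_intros

lemma computable_cong:
  "(\<And>xs. length xs = n \<Longrightarrow> f xs = g xs) \<Longrightarrow> computable n f \<longleftrightarrow> computable n g"
  by (simp add: computable_def)

lemma computable_arg [computable_intros]: "i < n \<Longrightarrow> computable n (\<lambda>xs. xs ! i)"
  unfolding computable_def by (rule exI[of _ "Proj i"]) (auto intro: rec_eval.Proj)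

lemma computable_compose:
  assumes "computable (length fs) g" "\<And>f. f \<in> set fs \<Longrightarrow> computable n f"
  shows "computable n (\<lambda>xs. g (map (\<lambda>f. f xs) fs))"
proof -
  obtain r where r: "\<And>ys. length ys = length fs \<Longrightarrow> rec_eval r ys (g ys)"
    using assms(1) by (auto simp: computable_def)
  define s where "s f = (SOME r. \<forall>xs. length xs = n \<longrightarrow> rec_eval r xs (f xs))" for f
  have s: "rec_eval (s f) xs (f xs)" if "f \<in> set fs" "length xs = n" for f xs
    using someI_ex[OF assms(2)[OF that(1), unfolded computable_def], folded s_def] that(2) by blast
  show ?thesis unfolding computable_def
  proof (intro exI[of _ "Comp r (map s fs)"] allI impI)
    fix xs :: "nat list" assume "length xs = n"
    then show "rec_eval (Comp r (map s fs)) xs (g (map (\<lambda>f. f xs) fs))"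
      by (intro rec_eval.Comp[of xs _ "map (\<lambda>f. f xs) fs"] r)
        (auto simp: list_all2_conv_all_nth s)
  qed
qed

lemma computable_compose1:
  "computable 1 (\<lambda>xs. g (xs ! 0)) \<Longrightarrow> computable n f \<Longrightarrow> computable n (\<lambda>xs. g (f xs))"
  using computable_compose[of "[f]" "\<lambda>xs. g (xs ! 0)" n] by simp

lemma computable_compose2:
  "computable 2 (\<lambda>xs. g (xs ! 0) (xs ! 1)) \<Longrightarrow> computable n f \<Longrightarrow> computable n f' \<Longrightarrow>
    computable n (\<lambda>xs. g (f xs) (f' xs))"
  using computable_compose[of "[f, f']" "\<lambda>xs. g (xs ! 0) (xs ! 1)" n]
  by (auto simp: numeral_2_eq_2)

lemma map_nth_shift: "length xs = m + n \<Longrightarrow> map (\<lambda>i. xs ! (m + i)) [0..<n] = drop m xs"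
  by (intro nth_equalityI) auto

lemma computable_drop:
  assumes "computable n f" shows "computable (m + n) (\<lambda>xs. f (drop m xs))"
proof -
  have "computable (m + n) (\<lambda>xs. f (map (\<lambda>g. g xs) (map (\<lambda>i xs. xs ! (m + i)) [0..<n])))"
    by (rule computable_compose) (use assms in \<open>auto intro: computable_arg\<close>)
  then show ?thesis
    by (subst computable_cong) (auto simp: comp_def map_nth_shift)
qed

lemma computable_drop_arg [computable_intros]: "m + i < n \<Longrightarrow> computable n (\<lambda>xs. drop m xs ! i)"
  using computable_arg[of "m + i" n] by (subst computable_cong) auto

lemma computable_drop_drop_arg [computable_intros]:
  "l + m + i < n \<Longrightarrow> computable n (\<lambda>xs. drop l (drop m xs) ! i)"
  using computable_drop_arg[of "l + m" i n] by (simp add: ac_simps)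

lemma computable_Suc [computable_intros]: "computable n f \<Longrightarrow> computable n (\<lambda>xs. Suc (f xs))"
proof (rule computable_compose1[of Suc])
  show "computable 1 (\<lambda>xs. Suc (xs ! 0))"
    unfolding computable_def
    by (rule exI[of _ Succ]) (auto simp: length_Suc_conv intro: rec_eval.Succ)
qed

lemma computable_const [computable_intros]: "computable n (\<lambda>_. c)"
proof (induction c)
  case 0
  show ?case unfolding computable_def by (rule exI[of _ Zero]) (auto intro: rec_eval.Zero)
qed (rule computable_Suc)

text \<open>
  Primitive recursion with parameters: the step sees the counter, the previous value, and then
  the parameters.
\<close>

lemma computable_rec:
  assumes "computable (Suc (Suc n)) (\<lambda>ys. s (ys ! 0) (ys ! 1) (drop 2 ys))"
    and "computable n a" "computable n b"
  shows "computable n (\<lambda>xs. rec_nat (a xs) (\<lambda>k r. s k r xs) (b xs))"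
proof -
  obtain ra where ra: "\<And>xs. length xs = n \<Longrightarrow> rec_eval ra xs (a xs)"
    using assms(2) by (auto simp: computable_def)
  obtain rs where "\<And>ys. length ys = Suc (Suc n) \<Longrightarrow>
      rec_eval rs ys (s (ys ! 0) (ys ! 1) (drop 2 ys))"
    using assms(1) unfolding computable_def by blast
  from this[of "_ # _ # _"] have rs: "rec_eval rs (k # r # xs) (s k r xs)"
    if "length xs = n" for k r xs using that by simp
  have step: "rec_eval (PrimRec ra rs) (k # xs) (rec_nat (a xs) (\<lambda>k r. s k r xs) k)"
    if "length xs = n" for k xs
    by (induction k) (use ra rs that in \<open>auto intro: rec_eval.PrimRec_0 rec_eval.PrimRec_Suc\<close>)
  have "computable (Suc n) (\<lambda>ys. rec_nat (a (drop 1 ys)) (\<lambda>k r. s k r (drop 1 ys)) (ys ! 0))"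
    unfolding computable_def
  proof (intro exI[of _ "PrimRec ra rs"] allI impI)
    fix ys :: "nat list" assume "length ys = Suc n"
    then obtain k xs where "ys = k # xs" "length xs = n" by (cases ys) auto
    then show "rec_eval (PrimRec ra rs) ys
        (rec_nat (a (drop 1 ys)) (\<lambda>k r. s k r (drop 1 ys)) (ys ! 0))"
      using step by simp
  qed
  then have "computable n (\<lambda>xs. (\<lambda>ys. rec_nat (a (drop 1 ys)) (\<lambda>k r. s k r (drop 1 ys)) (ys ! 0))
      (map (\<lambda>g. g xs) (b # map (\<lambda>i xs. xs ! i) [0..<n])))"
    by (intro computable_compose) (auto intro: computable_arg assms)
  then show ?thesis
    by (subst computable_cong) (auto simp: comp_def map_nth_shift[of _ 0, simplified])
qed

lemma computable_add [computable_intros]: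
  assumes "computable n f" "computable n g" shows "computable n (\<lambda>xs. f xs + g xs)"
proof (rule computable_compose2[of "(+)", OF _ assms])
  have eq: "m + k = rec_nat m (\<lambda>_ r. Suc r) k" for m k by (induction k) auto
  show "computable 2 (\<lambda>xs. xs ! 0 + xs ! 1)"
    unfolding eq by (intro computable_rec computable_intros) auto
qed

lemma computable_mult [computable_intros]:
  assumes "computable n f" "computable n g" shows "computable n (\<lambda>xs. f xs * g xs)"
proof (rule computable_compose2[of "(*)", OF _ assms])
  have eq: "m * k = rec_nat 0 (\<lambda>_ r. r + m) k" for m k :: nat by (induction k) auto
  show "computable 2 (\<lambda>xs. xs ! 0 * xs ! 1)"
    unfolding eq by (intro computable_rec computable_intros) auto
qed

lemma computable_power [computable_intros]:
  assumes "computable n f" "computable n g" shows "computable n (\<lambda>xs. f xs ^ g xs)"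
proof (rule computable_compose2[of "(^)", OF _ assms])
  have eq: "m ^ k = rec_nat 1 (\<lambda>_ r. r * m) k" for m k :: nat by (induction k) auto
  show "computable 2 (\<lambda>xs. xs ! 0 ^ xs ! 1)"
    unfolding eq by (intro computable_rec computable_intros) auto
qed

lemma computable_fact [computable_intros]:
  assumes "computable n f" shows "computable n (\<lambda>xs. fact (f xs))"
proof (rule computable_compose1[of fact, OF _ assms])
  have eq: "fact k = rec_nat 1 (\<lambda>k r. Suc k * r) k" for k :: nat by (induction k) auto
  show "computable 1 (\<lambda>xs. fact (xs ! 0))"
    unfolding eq by (intro computable_rec computable_intros) auto
qed

lemma computable_diff [computable_intros]:
  assumes "computable n f" "computable n g" shows "computable n (\<lambda>xs. f xs - g xs)"
proof (rule computable_compose2[of "(-)", OF _ assms])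
  have 1: "k - 1 = rec_nat 0 (\<lambda>k r. k) k" for k :: nat by (cases k) auto
  have "computable 1 (\<lambda>xs. xs ! 0 - 1)"
    unfolding 1 by (intro computable_rec computable_intros) auto
  note pred = computable_compose1[of "\<lambda>k. k - 1", OF this]
  have eq: "m - k = rec_nat m (\<lambda>_ r. r - 1) k" for m k :: nat by (induction k) auto
  have "computable 2 (\<lambda>xs. rec_nat (xs ! 0) (\<lambda>_ r. r - 1) (xs ! 1))"
    by (intro computable_rec computable_intros pred) auto
  then show "computable 2 (\<lambda>xs. xs ! 0 - xs ! 1)"
    unfolding eq[symmetric] .
qed

subsection \<open>Decidable relations\<close>

lemma computable_if [computable_intros]:
  assumes "decidable n P" "computable n f" "computable n g"
  shows "computable n (\<lambda>xs. if P xs then f xs else g xs)"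
proof -
  have "computable n (\<lambda>xs. (if P xs then 1 else 0) * f xs + (1 - (if P xs then 1 else 0)) * g xs)"
    by (intro computable_intros assms assms(1)[unfolded decidable_def])
  then show ?thesis by (subst computable_cong) auto
qed

lemma decidable_cong:
  "(\<And>xs. length xs = n \<Longrightarrow> P xs = Q xs) \<Longrightarrow> decidable n P \<longleftrightarrow> decidable n Q"
  unfolding decidable_def by (rule computable_cong) simp

lemma decidable_less [computable_intros]:
  assumes "computable n f" "computable n g" shows "decidable n (\<lambda>xs. f xs < g xs)"
proof -
  have "computable n (\<lambda>xs. 1 - (1 - (g xs - f xs)))" by (intro computable_intros assms)
  then show ?thesis unfolding decidable_def by (subst computable_cong) auto
qed

lemma decidable_not [computable_intros]:
  assumes "decidable n P" shows "decidable n (\<lambda>xs. \<not> P xs)"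
proof -
  have "computable n (\<lambda>xs. if P xs then 0 else 1)" by (intro computable_intros assms)
  then show ?thesis unfolding decidable_def by (subst computable_cong) auto
qed

lemma decidable_conj [computable_intros]:
  assumes "decidable n P" "decidable n Q" shows "decidable n (\<lambda>xs. P xs \<and> Q xs)"
proof -
  have "computable n (\<lambda>xs. if P xs then if Q xs then 1 else 0 else 0)" by (intro computable_intros assms)
  then show ?thesis unfolding decidable_def by (subst computable_cong) auto
qed

lemma decidable_disj [computable_intros]:
  assumes "decidable n P" "decidable n Q" shows "decidable n (\<lambda>xs. P xs \<or> Q xs)"
proof -
  have "decidable n (\<lambda>xs. \<not> (\<not> P xs \<and> \<not> Q xs))" by (intro computable_intros assms)
  then show ?thesis by simp
qed

lemma decidable_imp [computable_intros]:
  assumes "decidable n P" "decidable n Q" shows "decidable n (\<lambda>xs. P xs \<longrightarrow> Q xs)"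
proof -
  have "decidable n (\<lambda>xs. \<not> P xs \<or> Q xs)" by (intro computable_intros assms)
  then show ?thesis by (subst decidable_cong) auto
qed

lemma decidable_le [computable_intros]:
  assumes "computable n f" "computable n g" shows "decidable n (\<lambda>xs. f xs \<le> g xs)"
proof -
  have "decidable n (\<lambda>xs. \<not> g xs < f xs)" by (intro computable_intros assms)
  then show ?thesis by (subst decidable_cong) auto
qed

lemma decidable_eq [computable_intros]:
  assumes "computable n f" "computable n g" shows "decidable n (\<lambda>xs. f xs = g xs)"
proof -
  have "decidable n (\<lambda>xs. f xs \<le> g xs \<and> g xs \<le> f xs)" by (intro computable_intros assms)
  then show ?thesis by (subst decidable_cong) auto
qed

lemma decidable_const: "decidable n (\<lambda>_. b)"
  unfolding decidable_def by (rule computable_const)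

lemma decidable_finite_all:
  assumes "finite I" "\<And>i. i \<in> I \<Longrightarrow> decidable n (P i)"
  shows "decidable n (\<lambda>xs. \<forall>i\<in>I. P i xs)"
  using assms by (induction I) (auto intro: computable_intros decidable_const)

lemma decidable_finite_ex:
  assumes "finite I" "\<And>i. i \<in> I \<Longrightarrow> decidable n (P i)"
  shows "decidable n (\<lambda>xs. \<exists>i\<in>I. P i xs)"
  using assms by (induction I) (auto intro: computable_intros decidable_const)

lemma decidable_in_finite: "finite I \<Longrightarrow> computable n f \<Longrightarrow> decidable n (\<lambda>xs. f xs \<in> I)"
  using decidable_finite_ex[of I n "\<lambda>i xs. f xs = i"] by (simp add: computable_intros)

lemma decidable_bounded_ex [computable_intros]:
  assumes "decidable (Suc n) (\<lambda>ys. P (ys ! 0) (drop 1 ys))" "computable n b"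
  shows "decidable n (\<lambda>xs. \<exists>k<b xs. P k xs)"
proof -
  have 1: "computable (Suc n) (\<lambda>ys. if P (ys ! 0) (drop 1 ys) then 1 else 0)"
    using assms(1) unfolding decidable_def .
  have "computable (Suc (Suc n)) (\<lambda>ys. (\<lambda>ys. if P (ys ! 0) (drop 1 ys) then 1 else 0)
      (map (\<lambda>g. g ys) ((\<lambda>xs. xs ! 0) # map (\<lambda>i xs. xs ! (2 + i)) [0..<n])))"
    by (rule computable_compose) (use 1 in \<open>auto intro: computable_intros\<close>)
  then have "computable (Suc (Suc n)) (\<lambda>ys. if P (ys ! 0) (drop 2 ys) then 1 else 0)"
    by (subst computable_cong) (auto simp: comp_def map_nth_shift[of _ 2, simplified])
  then have "decidable (Suc (Suc n)) (\<lambda>ys. P (ys ! 0) (drop 2 ys))"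
    unfolding decidable_def .
  then have "computable n (\<lambda>xs. rec_nat 0 (\<lambda>k r. if P k xs then 1 else r) (b xs))"
    by (intro computable_rec computable_intros assms) auto
  moreover have "rec_nat 0 (\<lambda>k r. if P k xs then 1 else r) m = (if \<exists>k<m. P k xs then 1 else 0 :: nat)"
    for m xs by (induction m) (auto simp: less_Suc_eq)
  ultimately show ?thesis unfolding decidable_def by (subst computable_cong) auto
qed

lemma decidable_bounded_all [computable_intros]:
  assumes "decidable (Suc n) (\<lambda>ys. P (ys ! 0) (drop 1 ys))" "computable n b"
  shows "decidable n (\<lambda>xs. \<forall>k<b xs. P k xs)"
proof -
  have "decidable n (\<lambda>xs. \<not> (\<exists>k<b xs. \<not> P k xs))" by (intro computable_intros assms)
  then show ?thesis by (subst decidable_cong) auto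
qed

text \<open>
  Bounded search: a function with a decidable graph and a computable bound is computable. This
  inverts the pairing function.
\<close>

lemma computable_unique:
  assumes "decidable (Suc n) (\<lambda>ys. ys ! 0 = f (drop 1 ys))"
    and "computable n b" "\<And>xs. length xs = n \<Longrightarrow> f xs < b xs"
  shows "computable n f"
proof -
  have 1: "computable (Suc n) (\<lambda>ys. if ys ! 0 = f (drop 1 ys) then 1 else 0)"
    using assms(1) unfolding decidable_def .
  have "computable (Suc (Suc n)) (\<lambda>ys. (\<lambda>ys. if ys ! 0 = f (drop 1 ys) then 1 else 0)
      (map (\<lambda>g. g ys) ((\<lambda>xs. xs ! 0) # map (\<lambda>i xs. xs ! (2 + i)) [0..<n])))"
    by (rule computable_compose) (use 1 in \<open>auto intro: computable_intros\<close>)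
  then have "computable (Suc (Suc n)) (\<lambda>ys. if ys ! 0 = f (drop 2 ys) then 1 else 0)"
    by (subst computable_cong) (auto simp: comp_def map_nth_shift[of _ 2, simplified])
  then have "decidable (Suc (Suc n)) (\<lambda>ys. ys ! 0 = f (drop 2 ys))"
    unfolding decidable_def .
  then have "computable (Suc (Suc n)) (\<lambda>ys. if ys ! 0 = f (drop 2 ys) then ys ! 0 else ys ! 1)"
    by (rule computable_if) (auto intro: computable_intros)
  then have "computable n (\<lambda>xs. rec_nat 0 (\<lambda>k r. if k = f xs then k else r) (b xs))"
    by (intro computable_rec computable_const assms)
  moreover have "rec_nat 0 (\<lambda>k r. if k = c then k else r) m = (if c < m then c else 0)"
    for m c :: nat by (induction m) auto
  ultimately show ?thesis using assms(3) by (subst computable_cong) auto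
qed

subsection \<open>Computing with lists\<close>

lemma computable_prod_encode [computable_intros]:
  assumes "computable n f" "computable n g"
  shows "computable n (\<lambda>xs. prod_encode (f xs, g xs))"
proof -
  have eq: "triangle k = rec_nat 0 (\<lambda>k r. r + Suc k) k" for k by (induction k) auto
  have "computable 1 (\<lambda>xs. triangle (xs ! 0))"
    unfolding eq by (intro computable_rec computable_intros) auto
  note tri = computable_compose1[of triangle, OF this]
  show ?thesis
    unfolding prod_encode_def prod.case by (intro computable_add tri assms)
qed

lemma computable_fst_prod_decode:
  assumes "computable n f" shows "computable n (\<lambda>xs. fst (prod_decode (f xs)))"
proof (rule computable_compose1[OF computable_unique assms])
  have eq: "x = fst (prod_decode c) \<longleftrightarrow> (\<exists>y<Suc c. prod_encode (x, y) = c)" for x c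
  proof
    assume "x = fst (prod_decode c)"
    then have "prod_encode (x, snd (prod_decode c)) = c" by simp
    then show "\<exists>y<Suc c. prod_encode (x, y) = c" 
      using le_prod_encode_2[of "snd (prod_decode c)" x] by (metis less_Suc_eq_le)
  qed auto
  show "decidable (Suc 1) (\<lambda>ys. ys ! 0 = fst (prod_decode (drop 1 ys ! 0)))"
    unfolding eq by (intro computable_intros) auto
  show "computable 1 (\<lambda>xs. Suc (xs ! 0))" by (intro computable_intros) auto
  show "fst (prod_decode (xs ! 0)) < Suc (xs ! 0)" for xs
    using le_prod_encode_1[of "fst (prod_decode (xs ! 0))" "snd (prod_decode (xs ! 0))"] by simp
qed

lemma computable_snd_prod_decode:
  assumes "computable n f" shows "computable n (\<lambda>xs. snd (prod_decode (f xs)))"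
proof (rule computable_compose1[OF computable_unique assms])
  have eq: "y = snd (prod_decode c) \<longleftrightarrow> prod_encode (fst (prod_decode c), y) = c" for y c
  proof
    assume "y = snd (prod_decode c)"
    then show "prod_encode (fst (prod_decode c), y) = c" by simp
  qed (metis prod_encode_inverse snd_conv)
  show "decidable (Suc 1) (\<lambda>ys. ys ! 0 = snd (prod_decode (drop 1 ys ! 0)))"
    unfolding eq by (intro computable_intros computable_fst_prod_decode) auto
  show "computable 1 (\<lambda>xs. Suc (xs ! 0))" by (intro computable_intros) auto
  show "snd (prod_decode (xs ! 0)) < Suc (xs ! 0)" for xs
    using le_prod_encode_2[of "snd (prod_decode (xs ! 0))" "fst (prod_decode (xs ! 0))"] by simp
qed

lemma computable_list_encode [computable_intros]:
  "computable_list n F \<Longrightarrow> computable n (\<lambda>xs. list_encode (F xs))"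
  by (simp add: computable_list_def)

lemma computable_list_decode [computable_intros]:
  "computable n f \<Longrightarrow> computable_list n (\<lambda>xs. list_decode (f xs))"
  by (simp add: computable_list_def)

lemma computable_list_const: "computable_list n (\<lambda>_. l)"
  by (simp add: computable_list_def computable_const)

lemma computable_list_Cons [computable_intros]:
  "computable n f \<Longrightarrow> computable_list n F \<Longrightarrow> computable_list n (\<lambda>xs. f xs # F xs)"
  by (auto simp: computable_list_def intro: computable_intros)

lemma computable_list_cong:
  "(\<And>xs. length xs = n \<Longrightarrow> F xs = G xs) \<Longrightarrow> computable_list n F \<longleftrightarrow> computable_list n G"
  unfolding computable_list_def by (rule computable_cong) simp

lemma computable_list_compose1:
  assumes "computable_list 1 (\<lambda>xs. H (list_decode (xs ! 0)))" "computable_list n F"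
  shows "computable_list n (\<lambda>xs. H (F xs))"
  using computable_compose1[of "\<lambda>c. list_encode (H (list_decode c))" n "\<lambda>xs. list_encode (F xs)"]
    assms by (simp add: computable_list_def)

lemma computable_list_compose2:
  assumes "computable_list 2 (\<lambda>xs. H (list_decode (xs ! 0)) (list_decode (xs ! 1)))"
    "computable_list n F" "computable_list n G"
  shows "computable_list n (\<lambda>xs. H (F xs) (G xs))"
  using computable_compose2[of "\<lambda>c d. list_encode (H (list_decode c) (list_decode d))" n
      "\<lambda>xs. list_encode (F xs)" "\<lambda>xs. list_encode (G xs)"]
    assms by (simp add: computable_list_def)

lemma decidable_list_eq [computable_intros]:
  assumes "computable_list n F" "computable_list n G" shows "decidable n (\<lambda>xs. F xs = G xs)"
proof -
  have "decidable n (\<lambda>xs. list_encode (F xs) = list_encode (G xs))" by (intro computable_intros assms)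
  then show ?thesis by (simp add: list_encode_eq)
qed

lemma computable_list_if [computable_intros]:
  assumes "decidable n P" "computable_list n F" "computable_list n G"
  shows "computable_list n (\<lambda>xs. if P xs then F xs else G xs)"
  using computable_if[OF assms(1), of "\<lambda>xs. list_encode (F xs)" "\<lambda>xs. list_encode (G xs)"] assms
  by (simp add: computable_list_def if_distrib)

lemma computable_list_rec:
  assumes "computable_list (Suc (Suc n)) (\<lambda>ys. S (ys ! 0) (list_decode (ys ! 1)) (drop 2 ys))"
    and "computable_list n A" "computable n b"
  shows "computable_list n (\<lambda>xs. rec_nat (A xs) (\<lambda>k R. S k R xs) (b xs))"
proof -
  have "computable n (\<lambda>xs. rec_nat (list_encode (A xs))
      (\<lambda>k r. list_encode (S k (list_decode r) xs)) (b xs))"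
    using assms by (intro computable_rec) (auto simp: computable_list_def)
  moreover have "rec_nat (list_encode (A xs)) (\<lambda>k r. list_encode (S k (list_decode r) xs)) m =
      list_encode (rec_nat (A xs) (\<lambda>k R. S k R xs) m)" for m xs
    by (induction m) auto
  ultimately show ?thesis by (simp add: computable_list_def)
qed

lemma list_decode_pos: "list_decode c = fst (prod_decode (c - 1)) # list_decode (snd (prod_decode (c - 1)))"
  if "c \<noteq> 0"
  using that by (cases c) (auto split: prod.splits)

lemma computable_list_tl:
  assumes "computable_list n F" shows "computable_list n (\<lambda>xs. tl (F xs))"
proof (rule computable_list_compose1[OF _ assms])
  have eq: "tl (list_decode c) = (if c = 0 then [] else list_decode (snd (prod_decode (c - 1))))"
    for c by (auto simp: list_decode_pos)
  show "computable_list 1 (\<lambda>xs. tl (list_decode (xs ! 0)))"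
    unfolding eq by (intro computable_intros computable_list_const computable_snd_prod_decode) auto
qed

lemma computable_list_drop [computable_intros]:
  assumes "computable_list n F" "computable n f"
  shows "computable_list n (\<lambda>xs. drop (f xs) (F xs))"
proof -
  have eq: "drop k l = rec_nat l (\<lambda>_ R. tl R) k" for k and l :: "nat list"
    by (induction k) (simp_all add: drop_Suc flip: tl_drop)
  show ?thesis unfolding eq
    by (intro computable_list_rec computable_list_tl computable_intros assms) auto
qed

lemma computable_nth_default [computable_intros]:
  assumes "computable_list n F" "computable n f"
  shows "computable n (\<lambda>xs. nth_default 0 (F xs) (f xs))"
proof -
  have eq: "nth_default 0 (list_decode c) 0 = (if c = 0 then 0 else fst (prod_decode (c - 1)))"
    for c by (auto simp: list_decode_pos)
  have "computable 1 (\<lambda>xs. nth_default 0 (list_decode (xs ! 0)) 0)"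
    unfolding eq by (intro computable_intros computable_fst_prod_decode) auto
  then have "computable n (\<lambda>xs. nth_default 0 (list_decode (list_encode (drop (f xs) (F xs)))) 0)"
    by (rule computable_compose1) (intro computable_intros assms)
  moreover have "nth_default 0 (drop k l) 0 = nth_default 0 l k" for k and l :: "nat list"
    by (auto simp: nth_default_def)
  ultimately show ?thesis by simp
qed

lemma length_le_list_encode: "length l \<le> list_encode l"
proof (induction l)
  case (Cons a l)
  then show ?case using le_prod_encode_2[of "list_encode l" a] by simp
qed simp

text \<open>
  Primitive recursion runs through the list from its end. The code of a list is at least its
  length and serves as the number of steps; the steps before the end of the list is reached do
  nothing.
\<close>

lemma computable_foldr:
  assumes "computable_list n F" "computable n z"
    and "computable (Suc (Suc n)) (\<lambda>ys. g (ys ! 0) (ys ! 1) (drop 2 ys))"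
  shows "computable n (\<lambda>xs. foldr (\<lambda>a r. g a r xs) (F xs) (z xs))"
proof -
  define s where "s L k r xs = (let i = list_encode L - Suc k in
      if i < length L then g (L ! i) r xs else r)" for L k r xs
  have run: "rec_nat (z xs) (\<lambda>k r. s L k r xs) m =
      foldr (\<lambda>a r. g a r xs) (drop (list_encode L - m) L) (z xs)" 
    if "m \<le> list_encode L" for L m xs
    using that
  proof (induction m)
    case 0
    then show ?case using length_le_list_encode[of L] by simp
  next
    case (Suc m)
    then have "list_encode L - m = Suc (list_encode L - Suc m)" by simp
    with Suc show ?case
      by (cases "list_encode L - Suc m < length L") (auto simp: s_def Let_def Cons_nth_drop_Suc[symmetric])
  qed
  have eq: "s L k r xs = (if drop (list_encode L - Suc k) L = [] then r
      else g (nth_default 0 L (list_encode L - Suc k)) r xs)" for L k r xs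
    by (auto simp: s_def Let_def nth_default_def)
  let ?i = "\<lambda>ys. list_encode (F (drop 2 ys)) - Suc (ys ! 0)"
  have F: "computable_list (Suc (Suc n)) (\<lambda>ys. F (drop 2 ys))"
    using computable_drop[of n "\<lambda>xs. list_encode (F xs)" 2] assms(1)
    by (simp add: computable_list_def)
  have i: "computable (Suc (Suc n)) (\<lambda>ys. nth_default 0 (F (drop 2 ys)) (?i ys))"
    by (intro computable_intros F) auto
  have "computable (Suc (Suc n)) (\<lambda>ys. (\<lambda>ys. g (ys ! 0) (ys ! 1) (drop 2 ys))
      (map (\<lambda>h. h ys) ((\<lambda>ys. nth_default 0 (F (drop 2 ys)) (?i ys)) # (\<lambda>ys. ys ! 1) #
        map (\<lambda>i xs. xs ! (2 + i)) [0..<n])))"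
    by (rule computable_compose) (use assms(3) i in \<open>auto intro: computable_arg\<close>)
  then have g: "computable (Suc (Suc n))
      (\<lambda>ys. g (nth_default 0 (F (drop 2 ys)) (?i ys)) (ys ! 1) (drop 2 ys))"
    by (subst computable_cong) (auto simp: comp_def map_nth_shift[of _ 2, simplified])
  have "computable n (\<lambda>xs. rec_nat (z xs) (\<lambda>k r. s (F xs) k r xs) (list_encode (F xs)))"
    unfolding eq by (intro computable_rec computable_intros g assms F computable_list_const) auto
  then show ?thesis by (simp add: run)
qed

lemma computable_list_foldr:
  assumes "computable_list n F" "computable_list n Z"
    and "computable_list (Suc (Suc n)) (\<lambda>ys. G (ys ! 0) (list_decode (ys ! 1)) (drop 2 ys))"
  shows "computable_list n (\<lambda>xs. foldr (\<lambda>a R. G a R xs) (F xs) (Z xs))"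
proof -
  have "computable n (\<lambda>xs. foldr (\<lambda>a r. list_encode (G a (list_decode r) xs)) (F xs)
      (list_encode (Z xs)))"
    using assms by (intro computable_foldr) (auto simp: computable_list_def)
  moreover have "foldr (\<lambda>a r. list_encode (G a (list_decode r) xs)) l (list_encode z) =
      list_encode (foldr (\<lambda>a R. G a R xs) l z)" for l z xs
    by (induction l) auto
  ultimately show ?thesis by (simp add: computable_list_def)
qed

lemma computable_list_append [computable_intros]:
  assumes "computable_list n F" "computable_list n G"
  shows "computable_list n (\<lambda>xs. F xs @ G xs)"
proof (rule computable_list_compose2[OF _ assms])
  have eq: "l @ m = foldr (\<lambda>a R. a # R) l m" for l m :: "nat list" by (induction l) auto
  show "computable_list 2 (\<lambda>xs. list_decode (xs ! 0) @ list_decode (xs ! 1))"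
    unfolding eq by (intro computable_list_foldr computable_intros) auto
qed

lemma computable_length [computable_intros]:
  assumes "computable_list n F" shows "computable n (\<lambda>xs. length (F xs))"
proof -
  have eq: "length l = foldr (\<lambda>a r. Suc r) l 0" for l :: "nat list" by (induction l) auto
  show ?thesis unfolding eq by (intro computable_foldr computable_intros assms) auto
qed

lemma decidable_subset_lessThan [computable_intros]:
  assumes "computable_list n F" shows "decidable n (\<lambda>xs. set (F xs) \<subseteq> {..<m})"
proof -
  have "computable n (\<lambda>xs. foldr (\<lambda>a r. if a < m then r else 0) (F xs) 1)"
    by (intro computable_foldr computable_intros assms) auto
  moreover have "foldr (\<lambda>a r. if a < m then r else 0) l 1 = (if set l \<subseteq> {..<m} then 1 else 0 :: nat)"
    for l by (induction l) auto
  ultimately show ?thesis by (simp add: decidable_def)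
qed

lemma computable_list_replicate [computable_intros]:
  assumes "computable n f" shows "computable_list n (\<lambda>xs. replicate (f xs) c)"
proof -
  have eq: "replicate k c = rec_nat [] (\<lambda>_ R. c # R) k" for k by (induction k) auto
  show ?thesis unfolding eq by (intro computable_list_rec computable_intros assms computable_list_const) auto
qed

lemma computable_list_repeat [computable_intros]:
  assumes "computable_list n F" "computable n f"
  shows "computable_list n (\<lambda>xs. concat (replicate (f xs) (F xs)))"
proof -
  have eq: "concat (replicate k l) = rec_nat [] (\<lambda>_ R. l @ R) k" for k and l :: "nat list"
    by (induction k) auto
  have "computable_list 2 (\<lambda>xs. concat (replicate (xs ! 0) (list_decode (xs ! 1))))"
    unfolding eq by (intro computable_list_rec computable_intros computable_list_const) auto
  then show ?thesis
    using computable_compose2[of "\<lambda>k c. list_encode (concat (replicate k (list_decode c)))" n f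
        "\<lambda>xs. list_encode (F xs)"] assms
    by (simp add: computable_list_def)
qed

lemma computable_list_table:
  assumes "finite T" "computable n f"
  shows "computable_list n (\<lambda>xs. if f xs \<in> T then h (f xs) else [])"
  using assms(1)
proof (induction T)
  case (insert t T)
  have "computable_list n (\<lambda>xs. if f xs = t then h t else if f xs \<in> T then h (f xs) else [])"
    by (intro computable_intros assms computable_list_const insert.IH)
  then show ?case by (rule computable_list_cong[THEN iffD1, rotated]) auto
qed (simp add: computable_list_const)

text \<open>
  Homomorphisms of free monoids are computable on words over a finite alphabet \<open>T\<close>,
  whose table is part of the program. Letters outside \<open>T\<close> are erased to make the
  function total. The next lemma is the analogue for anti-homomorphisms such as formal
  inversion.
\<close>

lemma computable_list_hom:
  assumes "finite T" "computable_list n F"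
  shows "computable_list n (\<lambda>xs. concat (map (\<lambda>a. if a \<in> T then h a else []) (F xs)))"
proof -
  have eq: "concat (map g l) = foldr (\<lambda>a R. g a @ R) l []" for g and l :: "nat list"
    by (induction l) auto
  show ?thesis unfolding eq
    by (intro computable_list_foldr computable_intros assms computable_list_const computable_list_table) auto
qed

lemma computable_list_anti_hom:
  assumes "finite T" "computable_list n F"
  shows "computable_list n (\<lambda>xs. concat (map (\<lambda>a. if a \<in> T then h a else []) (rev (F xs))))"
proof -
  have eq: "concat (map g (rev l)) = foldr (\<lambda>a R. R @ g a) l []" for g and l :: "nat list"
    by (induction l) auto
  show ?thesis unfolding eq
    by (intro computable_list_foldr computable_intros assms computable_list_const computable_list_table) auto
qed

lemma computable_list_map_finite:
  assumes "\<And>i. i \<in> set js \<Longrightarrow> computable n (f i)"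
  shows "computable_list n (\<lambda>xs. map (\<lambda>i. f i xs) js)"
  using assms by (induction js) (auto intro: computable_intros computable_list_const)

subsection \<open>Recursion over the course of values\<close>

text \<open>
  The history of the function is a list that grows at its head, so the value at \<open>k <
  c\<close> is its entry \<open>c - Suc k\<close>.
\<close>

lemma computable_course_of_values:
  assumes "computable 2 (\<lambda>xs. s (xs ! 0) (list_decode (xs ! 1)))"
    and f: "\<And>c. f c = s c (map f (rev [0..<c]))"
  shows "computable 1 (\<lambda>xs. f (xs ! 0))"
proof -
  have hist: "map f (rev [0..<c]) = rec_nat [] (\<lambda>k R. s k R # R) c" for c
  proof (induction c)
    case (Suc c)
    then show ?case using f[of c] by simp
  qed simp
  have "computable_list 1 (\<lambda>xs. rec_nat [] (\<lambda>k R. s k R # R) (xs ! 0))"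
  proof (intro computable_list_rec computable_list_const computable_intros)
    show "computable (Suc (Suc 1)) (\<lambda>ys. s (ys ! 0) (list_decode (ys ! 1)))"
      by (rule computable_compose2[of "\<lambda>a b. s a (list_decode b)", OF assms(1)]) (auto intro: computable_intros)
  qed auto
  then have "computable 1 (\<lambda>xs. s (xs ! 0)
      (list_decode (list_encode (rec_nat [] (\<lambda>k R. s k R # R) (xs ! 0)))))"
    by (intro computable_compose2[of "\<lambda>a b. s a (list_decode b)", OF assms(1)] computable_intros) auto
  then show ?thesis by (simp add: hist[symmetric] f[symmetric])
qed

lemma nth_default_history: "k < c \<Longrightarrow> nth_default d (map f (rev [0..<c])) (c - Suc k) = f k"
  by (simp add: nth_default_def rev_nth)

section \<open>Context-free languages without grammars\<close>

text \<open>
  What a grammar in Chomsky normal form says about the languages of its nonterminals: a rule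
  \<open>M \<rightarrow> P Q\<close> becomes the inclusion of the product of \<open>P\<close>
  and \<open>Q\<close> in \<open>M\<close>. Stated in this way no normal form has to be
  constructed, and both the geometry of the graph and the membership test need only the family.
\<close>

definition splitting_family :: "'a list set set \<Rightarrow> bool" where
  "splitting_family \<F> \<longleftrightarrow> finite \<F> \<and> (\<forall>M\<in>\<F>. \<forall>w\<in>M. 2 \<le> length w \<longrightarrow>
     (\<exists>P\<in>\<F>. \<exists>Q\<in>\<F>. \<exists>u\<in>P. \<exists>v\<in>Q. u \<noteq> [] \<and> v \<noteq> [] \<and> w = u @ v \<and>
        (\<forall>p\<in>P. \<forall>q\<in>Q. p @ q \<in> M)))"

lemma splitting_familyE:
  assumes "splitting_family \<F>" "M \<in> \<F>" "w \<in> M" "2 \<le> length w"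
  obtains P Q u v where "P \<in> \<F>" "Q \<in> \<F>" "u \<in> P" "v \<in> Q" "u \<noteq> []" "v \<noteq> []" "w = u @ v"
    "\<And>p q. p \<in> P \<Longrightarrow> q \<in> Q \<Longrightarrow> p @ q \<in> M"
proof -
  have "\<exists>P\<in>\<F>. \<exists>Q\<in>\<F>. \<exists>u\<in>P. \<exists>v\<in>Q. u \<noteq> [] \<and> v \<noteq> [] \<and> w = u @ v \<and> (\<forall>p\<in>P. \<forall>q\<in>Q. p @ q \<in> M)"
    using assms unfolding splitting_family_def by blast
  then show thesis using that by blast
qed

subsection \<open>Grammars have splitting families\<close>

abbreviation derives_in :: "('n, 'a) productions \<Rightarrow> nat \<Rightarrow> ('n + 'a) list \<Rightarrow> ('n + 'a) list \<Rightarrow> bool" where "derives_in P n \<equiv> derives P ^^ n"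

lemma derives_append_cases:
  assumes "derives P (\<alpha> @ \<beta>) \<gamma>"
  obtains \<alpha>' where "derives P \<alpha> \<alpha>'" "\<gamma> = \<alpha>' @ \<beta>" | \<beta>' where "derives P \<beta> \<beta>'" "\<gamma> = \<alpha> @ \<beta>'"
  using assms
proof cases
  case (1 X r u v)
  from 1(1) consider s where "\<alpha> = u @ [Inl X] @ s" "s @ \<beta> = v" | s where "\<alpha> @ s = u" "\<beta> = s @ [Inl X] @ v"
    by (auto simp: append_eq_append_conv2 append_eq_Cons_conv Cons_eq_append_conv)
  then show thesis
  proof cases
    case 1
    then show thesis using that(1)[of "u @ r @ s"] derives.intros[OF \<open>(X, r) \<in> P\<close>, of u s] \<open>\<gamma> = _\<close>
      by auto
  next
    case 2
    then show thesis using that(2)[of "s @ r @ v"] derives.intros[OF \<open>(X, r) \<in> P\<close>, of s v] \<open>\<gamma> = _\<close>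
      by auto
  qed
qed

lemma derives_in_append:
  assumes "derives_in P n (\<alpha> @ \<beta>) \<gamma>"
  shows "\<exists>n1 n2 \<alpha>' \<beta>'. n = n1 + n2 \<and> \<gamma> = \<alpha>' @ \<beta>' \<and> derives_in P n1 \<alpha> \<alpha>' \<and> derives_in P n2 \<beta> \<beta>'"
  using assms
proof (induction n arbitrary: \<alpha> \<beta>)
  case 0
  then show ?case by auto
next
  case (Suc n)
  then obtain \<delta> where \<delta>: "derives P (\<alpha> @ \<beta>) \<delta>" "derives_in P n \<delta> \<gamma>"
    by (metis relpowp_Suc_D2)
  from \<delta>(1) show ?case
  proof (cases rule: derives_append_cases)
    case (1 \<alpha>')
    with \<delta> Suc.IH[of \<alpha>' \<beta>] obtain n1 n2 \<alpha>'' \<beta>'' where "n = n1 + n2" "\<gamma> = \<alpha>'' @ \<beta>''"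
      "derives_in P n1 \<alpha>' \<alpha>''" "derives_in P n2 \<beta> \<beta>''" by auto
    with 1 show ?thesis by (metis add_Suc relpowp_Suc_I2)
  next
    case (2 \<beta>')
    with \<delta> Suc.IH[of \<alpha> \<beta>'] obtain n1 n2 \<alpha>'' \<beta>'' where "n = n1 + n2" "\<gamma> = \<alpha>'' @ \<beta>''"
      "derives_in P n1 \<alpha> \<alpha>''" "derives_in P n2 \<beta>' \<beta>''" by auto
    with 2 show ?thesis by (metis add_Suc_right relpowp_Suc_I2)
  qed
qed

lemma derives_context: "derives P \<alpha> \<beta> \<Longrightarrow> derives P (u @ \<alpha> @ v) (u @ \<beta> @ v)"
  by (induction rule: derives.induct) (metis append.assoc derives.intros)

lemma rtranclp_derives_append:
  assumes "(derives P)\<^sup>*\<^sup>* \<alpha> \<alpha>'" "(derives P)\<^sup>*\<^sup>* \<beta> \<beta>'"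
  shows "(derives P)\<^sup>*\<^sup>* (\<alpha> @ \<beta>) (\<alpha>' @ \<beta>')"
proof -
  have ctx: "(derives P)\<^sup>*\<^sup>* (u @ \<gamma> @ v) (u @ \<delta> @ v)" if "(derives P)\<^sup>*\<^sup>* \<gamma> \<delta>" for u v \<gamma> \<delta>
    using that by (induction) (auto intro: derives_context rtranclp.rtrancl_into_rtrancl)
  from ctx[OF assms(1), of "[]" \<beta>] ctx[OF assms(2), of \<alpha>' "[]"] show ?thesis by simp
qed

definition form_language :: "('n, 'a) productions \<Rightarrow> ('n + 'a) list \<Rightarrow> 'a list set" where
  "form_language P \<alpha> = {w. (derives P)\<^sup>*\<^sup>* \<alpha> (map Inr w)}"

text \<open>The sentential forms that occur when right-hand sides are read from left to right, one
  symbol at a time.\<close>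

definition items :: "('n, 'a) productions \<Rightarrow> 'n \<Rightarrow> ('n + 'a) list set" where
  "items P S = insert [Inl S] (\<Union>(X, r)\<in>P. {\<alpha>. suffix \<alpha> r} \<union> (\<lambda>s. [s]) ` set r)"

lemma finite_items: "finite P \<Longrightarrow> finite (items P S)"
  using set_suffixes_eq by (auto simp: items_def simp flip: set_suffixes_eq)

lemma items_ConsD: "x # \<alpha> \<in> items P S \<Longrightarrow> [x] \<in> items P S \<and> (\<alpha> \<noteq> [] \<longrightarrow> \<alpha> \<in> items P S)"
  unfolding items_def by (auto 4 4 dest: suffix_ConsD set_mono_suffix)

text \<open>
  Induction on the number of derivation steps and the length of the form. A form of several
  symbols is divided after the first one. If one of the two parts derives the empty word here,
  the language of the other part is contained in that of the whole form, and the other part has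
  to be divided instead; this replaces the elimination of empty and of unit productions.
\<close>

lemma form_language_split:
  assumes "derives_in P n \<alpha> (map Inr w)" "\<alpha> \<in> items P S" "2 \<le> length w"
  shows "\<exists>\<beta>\<in>items P S. \<exists>\<gamma>\<in>items P S. \<exists>u\<in>form_language P \<beta>. \<exists>v\<in>form_language P \<gamma>.
    u \<noteq> [] \<and> v \<noteq> [] \<and> w = u @ v \<and>
    (\<forall>p\<in>form_language P \<beta>. \<forall>q\<in>form_language P \<gamma>. p @ q \<in> form_language P \<alpha>)"
  using assms
proof (induction "(n, length \<alpha>)" arbitrary: n \<alpha> rule: wf_induct_rule[OF wf_lex_prod[OF wf_less_than wf_less_than]])
  case 1
  have IH: "\<exists>\<beta>\<in>items P S. \<exists>\<gamma>\<in>items P S. \<exists>u\<in>form_language P \<beta>. \<exists>v\<in>form_language P \<gamma>.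
      u \<noteq> [] \<and> v \<noteq> [] \<and> w = u @ v \<and>
      (\<forall>p\<in>form_language P \<beta>. \<forall>q\<in>form_language P \<gamma>. p @ q \<in> form_language P \<alpha>)"
    if "derives_in P m \<delta> (map Inr w)" "\<delta> \<in> items P S"
      "m < n \<or> m \<le> n \<and> length \<delta> < length \<alpha>" "form_language P \<delta> \<subseteq> form_language P \<alpha>" for m \<delta>
  proof -
    have "((m, length \<delta>), n, length \<alpha>) \<in> less_than <*lex*> less_than" using that(3) by auto
    from "1.hyps"[OF this that(1,2) \<open>2 \<le> length w\<close>] that(4) show ?thesis by (meson subsetD)
  qed
  show ?case
  proof (cases \<alpha>)
    case Nil
    have "derives P [] \<delta> \<Longrightarrow> False" for \<delta> by (cases rule: derives.cases) auto
    with Nil 1(2) have "map Inr w = []" by (cases n) (auto dest!: relpowp_Suc_D2 simp del: relpowp.simps(2))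
    with 1(4) show ?thesis by simp
  next
    case (Cons x \<alpha>')
    show ?thesis
    proof (cases "\<alpha>' = []")
      case True
      show ?thesis
      proof (cases n)
        case 0
        with 1(2) Cons True have "length (map Inr w :: (_ + 'b) list) = 1" by auto
        with \<open>2 \<le> length w\<close> show ?thesis by simp
      next
        case (Suc m)
        with 1(2) obtain \<delta> where \<delta>: "derives P \<alpha> \<delta>" "derives_in P m \<delta> (map Inr w)"
          by (metis relpowp_Suc_D2)
        from \<delta>(1) Cons True obtain X where X: "x = Inl X" "(X, \<delta>) \<in> P"
          by cases (auto simp: Cons_eq_append_conv append_eq_Cons_conv)
        have "\<delta> \<in> items P S" using X by (auto simp: items_def)
        moreover have "form_language P \<delta> \<subseteq> form_language P \<alpha>"
          using \<delta>(1) by (auto simp: form_language_def intro: converse_rtranclp_into_rtranclp)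
        ultimately show ?thesis using IH[of m \<delta>] \<delta>(2) Suc by blast
      qed
    next
      case False
      have it: "[x] \<in> items P S" "\<alpha>' \<in> items P S"
        using items_ConsD[of x \<alpha>' P S] 1(3) Cons False by auto
      from derives_in_append[of n P "[x]" \<alpha>' "map Inr w"] 1(2) Cons obtain n1 n2 \<gamma> \<delta> where
        n: "n = n1 + n2" "map Inr w = \<gamma> @ \<delta>" "derives_in P n1 [x] \<gamma>" "derives_in P n2 \<alpha>' \<delta>"
        by auto
      from n(2) obtain u v where uv: "w = u @ v" "\<gamma> = map Inr u" "\<delta> = map Inr v"
        by (auto simp: map_eq_append_conv)
      have u: "u \<in> form_language P [x]" and v: "v \<in> form_language P \<alpha>'"
        using n uv by (auto simp: form_language_def intro: relpowp_imp_rtranclp)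
      have app: "p @ q \<in> form_language P \<alpha>"
        if "p \<in> form_language P [x]" "q \<in> form_language P \<alpha>'" for p q
        using rtranclp_derives_append[of P "[x]" "map Inr p" \<alpha>' "map Inr q"] that Cons
        by (auto simp: form_language_def)
      consider "u = []" | "v = []" | "u \<noteq> []" "v \<noteq> []" by blast
      then show ?thesis
      proof cases
        case 1
        have "form_language P \<alpha>' \<subseteq> form_language P \<alpha>" using app[of "[]"] u 1 by auto
        then show ?thesis using IH[of n2 \<alpha>'] n uv 1 it Cons by simp
      next
        case 2
        have "form_language P [x] \<subseteq> form_language P \<alpha>" using app[of _ "[]"] v 2 by auto
        then show ?thesis using IH[of n1 "[x]"] n uv 2 it Cons False by simp
      next
        case 3
        then show ?thesis using u v it uv app by blast
      qed
    qed
  qed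
qed

lemma context_free_splitting_family:
  assumes "context_free_language L"
  obtains \<F> where "splitting_family \<F>" "L \<in> \<F>"
proof -
  from assms obtain P :: "(nat, 'a) productions" and S
    where P: "finite P" and L: "L = grammar_language P S"
    by (auto simp: context_free_language_def)
  let ?F = "form_language P ` items P S"
  have "splitting_family ?F"
    unfolding splitting_family_def
  proof (intro conjI ballI impI)
    show "finite ?F" using finite_items[OF P] by simp
    fix M w assume M: "M \<in> ?F" "w \<in> M" "2 \<le> length w"
    then obtain \<alpha> where \<alpha>: "\<alpha> \<in> items P S" "M = form_language P \<alpha>" by auto
    with M obtain n where "derives_in P n \<alpha> (map Inr w)"
      by (auto simp: form_language_def rtranclp_power)
    from form_language_split[OF this \<alpha>(1) M(3)] \<alpha>(2)
    show "\<exists>P\<in>?F. \<exists>Q\<in>?F. \<exists>u\<in>P. \<exists>v\<in>Q. u \<noteq> [] \<and> v \<noteq> [] \<and> w = u @ v \<and> (\<forall>p\<in>P. \<forall>q\<in>Q. p @ q \<in> M)"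
      by blast
  qed
  moreover have "L \<in> ?F"
    by (auto simp: L grammar_language_def form_language_def items_def)
  ultimately show thesis by (rule that)
qed

subsection \<open>Membership is decidable\<close>

lemma list_encode_less_append: "v \<noteq> [] \<Longrightarrow> list_encode u < list_encode (u @ v)"
proof (induction u)
  case Nil
  then show ?case by (cases v) auto
next
  case (Cons a u)
  have mono: "prod_encode (a, m) < prod_encode (a, k)" if "m < k" for m k
    using that by (induction k rule: less_Suc_induct) (auto simp: prod_encode_def)
  show ?case using mono[OF Cons.IH[OF Cons.prems]] by simp
qed

lemma list_encode_less_append2: "u \<noteq> [] \<Longrightarrow> list_encode v < list_encode (u @ v)"
proof (induction u)
  case (Cons a u)
  have "list_encode (u @ v) < list_encode (a # u @ v)"
    using le_prod_encode_2[of "list_encode (u @ v)" a] by simp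
  with Cons show ?case by (cases "u = []") auto
qed simp

text \<open>
  The algorithm of Cocke, Younger and Kasami, with a table indexed by the codes of all words.
  Proper prefixes and suffixes of a word have smaller codes, so the table is filled by recursion
  over the course of values. The finite data of the family (which inclusions hold, and which
  words of length at most one belong to which language) are constants of the program.
\<close>

lemma splitting_family_decidable:
  fixes \<F> :: "nat list set set"
  assumes sf: "splitting_family \<F>" and M: "M \<in> \<F>" and B: "finite B" "\<Union>\<F> \<subseteq> lists B"
  shows "decidable 1 (\<lambda>xs. list_decode (xs ! 0) \<in> M)"
proof -
  obtain Ms where Ms: "\<F> = set Ms" using sf finite_list by (metis splitting_family_def)
  define m where "m = length Ms"
  define short where "short i = list_encode ` {w \<in> Ms ! i. length w \<le> 1}" for i
  define rules where
    "rules i = {(j, l) \<in> {..<m} \<times> {..<m}. \<forall>p\<in>Ms ! j. \<forall>q\<in>Ms ! l. p @ q \<in> Ms ! i}" for i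
  \<comment> \<open>the row of the table for the word with code \<open>c\<close>\<close>
  define row where "row c = list_encode (map (\<lambda>i. if list_decode c \<in> Ms ! i then 1 else 0) [0..<m])" for c
  \<comment> \<open>the answer for the word with code \<open>d\<close> and language \<open>j\<close>, looked up in the rows before \<open>c\<close>\<close>
  define entry where "entry h c d j = (nth_default 0 (list_decode (nth_default 0 h (c - Suc d))) j = 1)"
    for h :: "nat list" and c d j :: nat
  define test where "test c h i \<longleftrightarrow> c \<in> short i \<or> (\<exists>r\<in>rules i. \<exists>d<c. \<exists>e<c.
      list_decode d @ list_decode e = list_decode c \<and> entry h c d (fst r) \<and> entry h c e (snd r))" for c h i
  define s where "s c h = list_encode (map (\<lambda>i. if test c h i then 1 else 0) [0..<m])" for c h
  have short: "finite (short i)" if "i < m" for i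
  proof -
    have "{w \<in> Ms ! i. length w \<le> 1} \<subseteq> {w. set w \<subseteq> B \<and> length w \<le> 1}"
      using B(2) that Ms by (fastforce simp: m_def)
    then show ?thesis
      unfolding short_def using finite_lists_length_le[OF B(1)] finite_subset by blast
  qed
  have rules: "finite (rules i)" for i
    by (rule finite_subset[of _ "{..<m} \<times> {..<m}"]) (auto simp: rules_def)
  have comp_s: "computable 2 (\<lambda>xs. s (xs ! 0) (list_decode (xs ! 1)))"
    unfolding s_def test_def entry_def
    by (intro computable_list_encode computable_list_map_finite computable_if decidable_disj
        decidable_in_finite decidable_finite_ex short rules computable_intros) auto
  have row: "row c = s c (map row (rev [0..<c]))" for c
  proof -
    have entry: "entry (map row (rev [0..<c])) c d j \<longleftrightarrow> list_decode d \<in> Ms ! j"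
      if "d < c" "j < m" for d j
      using that unfolding entry_def nth_default_history[OF that(1)]
      by (auto simp: row_def nth_default_def)
    have "test c (map row (rev [0..<c])) i \<longleftrightarrow> list_decode c \<in> Ms ! i" if i: "i < m" for i
    proof
      assume "test c (map row (rev [0..<c])) i"
      then show "list_decode c \<in> Ms ! i"
        unfolding test_def
      proof
        assume "c \<in> short i" then show ?thesis by (auto simp: short_def)
      next
        assume "\<exists>r\<in>rules i. \<exists>d<c. \<exists>e<c. list_decode d @ list_decode e = list_decode c \<and>
          entry (map row (rev [0..<c])) c d (fst r) \<and> entry (map row (rev [0..<c])) c e (snd r)"
        then obtain j l d e where "(j, l) \<in> rules i" "d < c" "e < c"
          and de: "list_decode d @ list_decode e = list_decode c"
          and "entry (map row (rev [0..<c])) c d j" "entry (map row (rev [0..<c])) c e l" by auto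
        then have "list_decode d \<in> Ms ! j" "list_decode e \<in> Ms ! l"
          "\<forall>p\<in>Ms ! j. \<forall>q\<in>Ms ! l. p @ q \<in> Ms ! i" using entry by (auto simp: rules_def)
        then have "list_decode d @ list_decode e \<in> Ms ! i" by blast
        then show ?thesis by (simp only: de)
      qed
    next
      assume c: "list_decode c \<in> Ms ! i"
      show "test c (map row (rev [0..<c])) i"
      proof (cases "length (list_decode c) \<le> 1")
        case True
        then have "c \<in> short i" using c unfolding short_def
          by (intro image_eqI[of _ _ "list_decode c"]) auto
        then show ?thesis by (simp add: test_def)
      next
        case False
        have "Ms ! i \<in> \<F>" using i Ms by (simp add: m_def)
        from False have "2 \<le> length (list_decode c)" by simp
        from splitting_familyE[OF sf \<open>Ms ! i \<in> \<F>\<close> c this] obtain P Q u v where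
          PQ: "P \<in> \<F>" "Q \<in> \<F>" "u \<in> P" "v \<in> Q" "u \<noteq> []" "v \<noteq> []" "list_decode c = u @ v"
            "\<And>p q. p \<in> P \<Longrightarrow> q \<in> Q \<Longrightarrow> p @ q \<in> Ms ! i" by blast
        from PQ(1,2) obtain j l where jl: "j < m" "l < m" "P = Ms ! j" "Q = Ms ! l"
          by (metis Ms in_set_conv_nth m_def)
        have "c = list_encode (u @ v)" using PQ(7) by (metis list_decode_inverse)
        then have less: "list_encode u < c" "list_encode v < c"
          using PQ list_encode_less_append list_encode_less_append2 by auto
        moreover have "(j, l) \<in> rules i" using jl PQ(8) by (auto simp: rules_def)
        moreover have "entry (map row (rev [0..<c])) c (list_encode u) j"
          "entry (map row (rev [0..<c])) c (list_encode v) l"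
          using entry less jl PQ by auto
        ultimately have "\<exists>r\<in>rules i. \<exists>d<c. \<exists>e<c. list_decode d @ list_decode e = list_decode c \<and>
            entry (map row (rev [0..<c])) c d (fst r) \<and> entry (map row (rev [0..<c])) c e (snd r)"
          using PQ(7) by (intro bexI[of _ "(j, l)"] exI[of _ "list_encode u"] exI[of _ "list_encode v"] conjI) auto
        then show ?thesis unfolding test_def by blast
      qed
    qed
    then show ?thesis unfolding row_def s_def by (intro arg_cong[of _ _ list_encode] map_cong) auto
  qed
  obtain i where i: "i < m" "M = Ms ! i" using M Ms by (metis in_set_conv_nth m_def)
  have "decidable 1 (\<lambda>xs. nth_default 0 (list_decode (row (xs ! 0))) i = 1)"
    by (intro computable_intros computable_course_of_values[of s row, OF comp_s row])
  moreover have "nth_default 0 (list_decode (row c)) i = 1 \<longleftrightarrow> list_decode c \<in> M" for c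
    using i by (auto simp: row_def nth_default_def)
  ultimately show ?thesis by simp
qed

section \<open>Transitive actions of words\<close>

locale word_action = involutive_alphabet A iv
  for A :: "'a set" and iv :: "'a \<Rightarrow> 'a" +
  fixes V :: "'v set" and act :: "'v \<Rightarrow> 'a \<Rightarrow> 'v" and x\<^sub>0 :: 'v
  assumes act_closed: "v \<in> V \<Longrightarrow> a \<in> A \<Longrightarrow> act v a \<in> V"
    and act_iv: "v \<in> V \<Longrightarrow> a \<in> A \<Longrightarrow> act (act v a) (iv a) = v"
    and root: "x\<^sub>0 \<in> V"
    and transitive: "v \<in> V \<Longrightarrow> \<exists>u\<in>lists A. foldl act x\<^sub>0 u = v"
begin

abbreviation walk :: "'v \<Rightarrow> 'a list \<Rightarrow> 'v" where "walk \<equiv> foldl act"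

lemma walk_closed: "v \<in> V \<Longrightarrow> w \<in> lists A \<Longrightarrow> walk v w \<in> V"
  by (induction w arbitrary: v) (auto simp: act_closed)

lemma walk_word_inv: "v \<in> V \<Longrightarrow> w \<in> lists A \<Longrightarrow> walk (walk v w) (word_inv iv w) = v"
  by (induction w arbitrary: v) (auto simp: word_inv_def act_iv act_closed)

lemma length_word_inv: "length (word_inv iv w) = length w"
  by (simp add: word_inv_def)

lemma walk_cancel:
  "u \<in> V \<Longrightarrow> v \<in> V \<Longrightarrow> w \<in> lists A \<Longrightarrow> walk u w = walk v w \<Longrightarrow> u = v"
  using walk_word_inv by metis

definition level :: "'v \<Rightarrow> nat" where
  "level v = (LEAST n. \<exists>u\<in>lists A. length u = n \<and> walk x\<^sub>0 u = v)"

lemma geodesic: assumes "v \<in> V" obtains u where "u \<in> lists A" "length u = level v" "walk x\<^sub>0 u = v"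
proof -
  from transitive[OF assms] have "\<exists>n. \<exists>u\<in>lists A. length u = n \<and> walk x\<^sub>0 u = v" by blast
  from LeastI_ex[OF this] show thesis using that unfolding level_def by blast
qed

lemma level_walk_root: "u \<in> lists A \<Longrightarrow> level (walk x\<^sub>0 u) \<le> length u"
  unfolding level_def by (rule Least_le) auto

lemma level_walk: assumes "v \<in> V" "w \<in> lists A" shows "level (walk v w) \<le> level v + length w"
proof -
  obtain u where u: "u \<in> lists A" "length u = level v" "walk x\<^sub>0 u = v" using geodesic[OF assms(1)] .
  then show ?thesis using level_walk_root[of "u @ w"] assms by auto
qed

definition near :: "nat \<Rightarrow> 'v \<Rightarrow> 'v \<Rightarrow> bool" where
  "near k p q \<longleftrightarrow> (\<exists>s\<in>lists A. length s \<le> k \<and> walk p s = q)"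

lemma near_refl: "near k p p" by (auto simp: near_def intro!: bexI[of _ "[]"])

lemma near_mono: "near k p q \<Longrightarrow> k \<le> l \<Longrightarrow> near l p q"
  unfolding near_def by (meson le_trans)

lemma near_trans: "near k p q \<Longrightarrow> near l q r \<Longrightarrow> near (k + l) p r"
proof -
  assume "near k p q" "near l q r"
  then obtain s t where "s \<in> lists A" "length s \<le> k" "walk p s = q"
    "t \<in> lists A" "length t \<le> l" "walk q t = r" by (auto simp: near_def)
  then show "near (k + l) p r" unfolding near_def by (intro bexI[of _ "s @ t"]) auto
qed

lemma near_sym: assumes "p \<in> V" "near k p q" shows "near k q p"
proof -
  obtain s where "s \<in> lists A" "length s \<le> k" "walk p s = q" using assms(2) by (auto simp: near_def)
  then show ?thesis
    unfolding near_def using assms(1) walk_word_inv[of p s]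
    by (intro bexI[of _ "word_inv iv s"] word_inv_closed) (auto simp: length_word_inv)
qed

lemma level_near: "p \<in> V \<Longrightarrow> near k p q \<Longrightarrow> level q \<le> level p + k"
  unfolding near_def by (metis add_le_cancel_left level_walk le_trans)

definition above :: "nat \<Rightarrow> 'v \<Rightarrow> 'a list \<Rightarrow> bool" where
  "above n v z \<longleftrightarrow> (\<forall>z1 z2. z = z1 @ z2 \<longrightarrow> n \<le> level (walk v z1))"

lemma above_append: "above n v (y @ z) \<longleftrightarrow> above n v y \<and> above n (walk v y) z"
  (is "?l \<longleftrightarrow> ?r")
proof
  assume l: ?l
  have "n \<le> level (walk v y1)" if "y = y1 @ y2" for y1 y2
    using l that by (simp add: above_def)
  moreover have "n \<le> level (walk (walk v y) z1)" if "z = z1 @ z2" for z1 z2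
    using l[unfolded above_def, rule_format, of "y @ z1" z2] that by simp
  ultimately show ?r by (simp add: above_def)
next
  assume r: ?r
  show ?l
    unfolding above_def
  proof (intro allI impI)
    fix w1 w2 assume "y @ z = w1 @ w2"
    then consider s where "y = w1 @ s" | s where "w1 = y @ s" "z = s @ w2"
      by (auto simp: append_eq_append_conv2)
    then show "n \<le> level (walk v w1)" using r by cases (auto simp: above_def)
  qed
qed

lemma above_Nil: "above n v [] \<longleftrightarrow> n \<le> level v"
  by (simp add: above_def)

lemma above_Cons: "above n v (a # z) \<longleftrightarrow> n \<le> level v \<and> above n (act v a) z"
  using above_append[of n v "[a]" z] by (auto simp: above_def Cons_eq_append_conv)

lemma above_end: "above n v z \<Longrightarrow> n \<le> level (walk v z)"
  by (auto simp: above_def)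

definition circuits :: "'v \<Rightarrow> 'a list set" where
  "circuits v = {w \<in> lists A. walk v w = v}"

text \<open>
  The cone of \<open>v\<close> is recorded by labels of walks instead of vertices, which makes
  cones at different vertices comparable: an isomorphism between the parts of the graph above
  two vertices would make their cones equal.
\<close>

definition cone :: "'v \<Rightarrow> 'a list set" where
  "cone v = {z \<in> lists A. above (level v) v z}"

definition connects :: "'a list set \<Rightarrow> 'v \<Rightarrow> 'v \<Rightarrow> bool" where
  "connects M p q \<longleftrightarrow> M \<subseteq> lists A \<and> (\<forall>z\<in>M. walk p z = q)"

text \<open>
  The letters act injectively, so when all products lead from \<open>p\<close> to
  \<open>q\<close>, all words of the first language have to arrive at the same vertex.
\<close>

lemma connects_split:
  assumes "connects M p q" "p \<in> V" "u \<in> P" "v \<in> Q" "\<And>x y. x \<in> P \<Longrightarrow> y \<in> Q \<Longrightarrow> x @ y \<in> M"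
  shows "connects P p (walk p u)" "connects Q (walk p u) q"
proof -
  have M: "x @ y \<in> lists A" "walk (walk p x) y = q" if "x \<in> P" "y \<in> Q" for x y
    using assms(1) assms(5)[OF that] unfolding connects_def by (auto simp flip: foldl_append)
  show "connects P p (walk p u)"
    unfolding connects_def
  proof (intro conjI subsetI ballI)
    fix x assume x: "x \<in> P"
    show "x \<in> lists A" using M(1)[OF x \<open>v \<in> Q\<close>] by auto
    have "u \<in> lists A" "v \<in> lists A" using M(1)[OF assms(3,4)] by auto
    with \<open>x \<in> lists A\<close> show "walk p x = walk p u"
      using walk_cancel[of "walk p x" "walk p u" v] M(2) x assms(2-4) by (auto simp: walk_closed)
  qed
  show "connects Q (walk p u) q"
    unfolding connects_def using M[OF assms(3)] by fastforce
qed

text \<open>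
  A chain is a certificate that \<open>z\<close> leads from \<open>p\<close> to \<open>r\<close>
  which can be transported to other vertices: it mentions only finitely many vertices, those of
  \<open>U\<close>, and which languages of the family connect them.
\<close>

inductive chain :: "'a list set set \<Rightarrow> 'v set \<Rightarrow> 'v \<Rightarrow> 'a list \<Rightarrow> 'v \<Rightarrow> bool" for \<F> U where
  Nil: "chain \<F> U p [] p"
| Step: "M \<in> \<F> \<Longrightarrow> connects M p q \<Longrightarrow> y \<in> M \<Longrightarrow> q \<in> U \<Longrightarrow> chain \<F> U q z r \<Longrightarrow> chain \<F> U p (y @ z) r"

lemma chain_append: "chain \<F> U p y q \<Longrightarrow> chain \<F> U q z r \<Longrightarrow> chain \<F> U p (y @ z) r"
  by (induction rule: chain.induct) (auto intro: chain.Step)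

lemma chain_mono: "chain \<F> U p z q \<Longrightarrow> U \<subseteq> U' \<Longrightarrow> chain \<F> U' p z q"
  by (induction rule: chain.induct) (auto intro: chain.intros)

end

section \<open>Cone types of context-free actions\<close>

locale context_free_action = word_action A iv V act x\<^sub>0
  for A :: "'a set" and iv and V :: "'v set" and act x\<^sub>0 +
  fixes \<F> :: "'a list set set" and K :: nat
  assumes splitting: "splitting_family \<F>" and circuits_root: "circuits x\<^sub>0 \<in> \<F>"
    and short: "M \<in> \<F> \<Longrightarrow> M \<noteq> {} \<Longrightarrow> \<exists>w\<in>M. length w \<le> K"
begin

lemma connects_near: "M \<in> \<F> \<Longrightarrow> connects M p q \<Longrightarrow> z \<in> M \<Longrightarrow> near K p q"
  using short[of M] by (fastforce simp: connects_def near_def)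

text \<open>
  Here \<open>z\<close> is the middle part of a word of \<open>M\<close> whose outer parts
  \<open>t1\<close> and \<open>t2\<close> are empty or run along geodesics up to
  \<open>f\<close> and down from \<open>f'\<close>, at or below level \<open>n\<close>. The
  parse of the word is followed downwards. If it cuts inside \<open>z\<close>, at a vertex
  \<open>e\<close>, while \<open>t1\<close> is not empty, then a short word leads from the start
  \<open>p\<close> to \<open>e\<close>. The level of \<open>e\<close> is at least
  \<open>n\<close> and that of \<open>p\<close> is at most \<open>n - length t1\<close>, so
  \<open>t1\<close> is short too and \<open>e\<close> is close to \<open>f\<close>; the case of
  \<open>t2\<close> is symmetric.
\<close>

lemma chain_of_parse:
  assumes ff': "f \<in> V" "f' \<in> V"
    and U: "\<And>e. e \<in> V \<Longrightarrow> near (2 * K) f e \<or> near (2 * K) f' e \<Longrightarrow> e \<in> U"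
    and "M \<in> \<F>" "connects M p q" "t1 @ z @ t2 \<in> M" "p \<in> V"
    and "t1 = [] \<or> walk p t1 = f \<and> level p + length t1 \<le> n"
    and "t2 = [] \<or> walk p (t1 @ z) = f' \<and> level q + length t2 \<le> n"
    and "above n (walk p t1) z" "walk p (t1 @ z) \<in> U"
  shows "chain \<F> U (walk p t1) z (walk p (t1 @ z))"
  using assms(4-)
proof (induction "length (t1 @ z @ t2)" arbitrary: M p q t1 z t2 rule: less_induct)
  case less
  note M = less.prems(1) and con = less.prems(2) and w = less.prems(3) and p = less.prems(4)
    and t1 = less.prems(5) and t2 = less.prems(6) and z = less.prems(7) and U' = less.prems(8)
  have lists: "t1 \<in> lists A" "z \<in> lists A" "t2 \<in> lists A" and q: "walk p (t1 @ z @ t2) = q"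
    using con w by (auto simp: connects_def)
  then have qV: "q \<in> V" using walk_closed[OF p, of "t1 @ z @ t2"] by auto
  show ?case
  proof (cases "z = []")
    case True
    then show ?thesis by (auto intro: chain.Nil)
  next
    case z0: False
    show ?thesis
    proof (cases "t1 = [] \<and> t2 = []")
      case True
      then have "walk p (t1 @ z) = q" using q by simp
      with True chain.Step[OF M con, of z U "[]" q] w U' show ?thesis by (auto intro: chain.Nil)
    next
      case ne: False
      with z0 have "2 \<le> length (t1 @ z @ t2)" by (cases t1; cases t2; cases z) auto
      from splitting_familyE[OF splitting M w this] obtain P Q u v where
        PQ: "P \<in> \<F>" "Q \<in> \<F>" "u \<in> P" "v \<in> Q" "u \<noteq> []" "v \<noteq> []" "t1 @ z @ t2 = u @ v"
          "\<And>x y. x \<in> P \<Longrightarrow> y \<in> Q \<Longrightarrow> x @ y \<in> M" by blast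
      note con' = connects_split[OF con p PQ(3,4,8)]
      have uv: "u \<in> lists A" "v \<in> lists A" "walk (walk p u) v = q"
        using PQ(3,4) con' unfolding connects_def by blast+
      let ?e = "walk p u"
      have eV: "?e \<in> V" using uv p walk_closed by auto
      from PQ(7) consider (left) s where "t1 = u @ s" "v = s @ z @ t2"
        | (right) s where "u = t1 @ z @ s" "t2 = s @ v"
        | (mid) z1 z2 where "u = t1 @ z1" "v = z2 @ t2" "z = z1 @ z2"
        by (auto simp: append_eq_append_conv2)
      then show ?thesis
      proof cases
        case left
        have "level ?e \<le> level p + length u" using level_walk p uv by blast
        then have "chain \<F> U (walk ?e s) z (walk ?e (s @ z))"
          using left t1 t2 z U' PQ con' eV by (intro less.hyps[of s z t2 Q ?e q]) auto
        with left show ?thesis by simp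
      next
        case right
        have "level ?e \<le> level q + length v"
          using level_walk[OF qV word_inv_closed[OF uv(2)]] walk_word_inv[OF eV uv(2)] uv(3)
          by (simp add: length_word_inv)
        then show ?thesis
          using right t1 t2 z U' PQ con' p by (intro less.hyps[of t1 z s P p ?e]) auto
      next
        case mid
        have e: "walk p (t1 @ z1) = ?e" using mid by simp
        have "n \<le> level ?e" using z mid unfolding above_def by simp
        have "?e \<in> U"
        proof (cases "t1 = []")
          case False
          have pe: "near K p ?e" by (rule connects_near[OF PQ(1) con'(1) PQ(3)])
          with level_near[OF p] \<open>n \<le> level ?e\<close> have "level p + K \<ge> n" by fastforce
          with False t1 have "length t1 \<le> K" "walk p t1 = f" by auto
          with lists have "near K p f" unfolding near_def by blast
          from near_trans[OF near_sym[OF p this] pe] show ?thesis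
            using U[OF eV] by (simp add: mult_2)
        next
          case True
          with ne have "t2 \<noteq> []" by simp
          have eq: "near K ?e q" by (rule connects_near[OF PQ(2) con'(2) PQ(4)])
          with level_near[OF qV near_sym[OF eV eq]] \<open>n \<le> level ?e\<close> have "level q + K \<ge> n" by fastforce
          with \<open>t2 \<noteq> []\<close> t2 have "near K f' q"
            unfolding near_def using lists q by (intro bexI[of _ t2]) auto
          from near_trans[OF this near_sym[OF eV eq]] show ?thesis
            using U[OF eV] by (simp add: mult_2)
        qed
        have "chain \<F> U (walk p t1) z1 (walk p (t1 @ z1))"
          using mid t1 PQ con' p z \<open>?e \<in> U\<close> e
          by (intro less.hyps[of t1 z1 "[]" P p ?e]) (auto simp: above_append)
        moreover have "chain \<F> U (walk ?e []) z2 (walk ?e ([] @ z2))"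
          using mid t2 PQ con' eV z U' e
          by (intro less.hyps[of "[]" z2 t2 Q ?e q]) (auto simp: above_append)
        ultimately show ?thesis using e mid by (auto intro: chain_append)
      qed
    qed
  qed
qed

text \<open>
  Geodesics between the root and the end points of the walk complete it to a circuit at the
  root, to which the parsing lemma applies. The bound on the distance of the end points follows
  because consecutive vertices of the chain are at distance at most \<open>K\<close>, and the
  first one that is not close to \<open>f\<close> is close to the other end.
\<close>

lemma chain_of_return:
  assumes f: "f \<in> V" and z: "z \<in> cone f" and ret: "level (walk f z) = level f"
  shows "near (5 * K) f (walk f z)"
    and "chain \<F> {e. near (7 * K) f e} f z (walk f z)"
proof -
  let ?f = "walk f z" and ?U = "{e. near (2 * K) f e \<or> near (2 * K) (walk f z) e}"
  have zA: "z \<in> lists A" and ab: "above (level f) f z" using z by (auto simp: cone_def)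
  have f': "?f \<in> V" using f zA by (simp add: walk_closed)
  obtain x where x: "x \<in> lists A" "length x = level f" "walk x\<^sub>0 x = f" using geodesic[OF f] .
  obtain y where y: "y \<in> lists A" "length y = level ?f" "walk x\<^sub>0 y = ?f" using geodesic[OF f'] .
  have "walk ?f (word_inv iv y) = x\<^sub>0" using walk_word_inv[OF root y(1)] y by simp
  then have w: "x @ z @ word_inv iv y \<in> circuits x\<^sub>0"
    using x y zA word_inv_closed by (auto simp: circuits_def)
  have con: "connects (circuits x\<^sub>0) x\<^sub>0 x\<^sub>0" by (auto simp: connects_def circuits_def)
  have l0: "level x\<^sub>0 = 0" using level_walk_root[of "[]"] by simp
  have "chain \<F> ?U (walk x\<^sub>0 x) z (walk x\<^sub>0 (x @ z))"
    by (rule chain_of_parse[OF f f' _ circuits_root con w root])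
      (use x y ret ab in \<open>auto simp: l0 length_word_inv near_refl\<close>)
  then have ch: "chain \<F> ?U f z ?f" using x by simp
  have "near (5 * K) f ?f" if "chain \<F> ?U p z' q" "p \<in> V" "near (2 * K) f p" "q = ?f" for p z' q
    using that
  proof (induction rule: chain.induct)
    case (Nil p)
    then show ?case by (auto intro: near_mono)
  next
    case (Step M p q y z r)
    have pq: "near K p q" using Step.hyps by (blast intro: connects_near)
    have "y \<in> lists A" "walk p y = q" using Step.hyps(2,3) unfolding connects_def by blast+
    then have "q \<in> V" using walk_closed[OF Step.prems(1)] by blast
    show ?case
    proof (cases "near (2 * K) f q")
      case True
      then show ?thesis using Step.IH Step.prems \<open>q \<in> V\<close> by blast
    next
      case False
      then have "near (2 * K) q ?f" using Step.hyps(4) near_sym[OF f'] by auto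
      from near_trans[OF near_trans[OF Step.prems(2) pq] this] show ?thesis by (rule near_mono) simp
    qed
  qed
  from this[OF ch f near_refl refl] show near: "near (5 * K) f ?f" .
  have "?U \<subseteq> {e. near (7 * K) f e}"
    using near_trans[OF near] near_mono by fastforce
  from chain_mono[OF ch this] show "chain \<F> {e. near (7 * K) f e} f z ?f" .
qed

definition short_words :: "'a list set" where
  "short_words = {s \<in> lists A. length s \<le> 7 * K + 1}"

text \<open>
  The vertices near \<open>f\<close> are named by short words, so that types of different
  vertices can be compared. A type records which languages of the family connect these vertices,
  which of their names coincide, and their levels relative to \<open>f\<close>. Radius \<open>7
  * K\<close> is what chains need; the extra letter detects a descent below the level of
  \<open>f\<close>.
\<close>

definition local_type where
  "local_type f =
     ({(s, M, t) \<in> short_words \<times> \<F> \<times> short_words. connects M (walk f s) (walk f t)},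
      {(s, t) \<in> short_words \<times> short_words. walk f s = walk f t},
      {(s, d) \<in> short_words \<times> {- int (7 * K + 1)..int (7 * K + 1)}.
         int (level (walk f s)) = int (level f) + d})"

lemma finite_short_words: "finite short_words"
  using finite_lists_length_le[OF finite_A, of "7 * K + 1"]
  by (simp add: short_words_def lists_eq_set)

lemma finite_local_types: "finite (range local_type)"
proof -
  have "finite \<F>" using splitting by (simp add: splitting_family_def)
  then have "finite (Pow (short_words \<times> \<F> \<times> short_words) \<times> Pow (short_words \<times> short_words) \<times>
      Pow (short_words \<times> {- int (7 * K + 1)..int (7 * K + 1)}))"
    using finite_short_words by simp
  then show ?thesis by (rule rev_finite_subset) (auto simp: local_type_def)
qed

lemma local_type_connects:
  assumes "local_type f = local_type g" "M \<in> \<F>" "s \<in> short_words" "t \<in> short_words"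
    "connects M (walk f s) (walk f t)"
  shows "connects M (walk g s) (walk g t)"
proof -
  have "(s, M, t) \<in> fst (local_type f)" using assms(2-) by (simp add: local_type_def)
  then show ?thesis unfolding assms(1) by (simp add: local_type_def)
qed

lemma local_type_eq:
  assumes "local_type f = local_type g" "s \<in> short_words" "t \<in> short_words" "walk f s = walk f t"
  shows "walk g s = walk g t"
proof -
  have "(s, t) \<in> fst (snd (local_type f))" using assms(2-) by (simp add: local_type_def)
  then show ?thesis unfolding assms(1) by (simp add: local_type_def)
qed

lemma local_type_level:
  assumes "local_type f = local_type g" "s \<in> short_words" "f \<in> V"
  shows "int (level (walk g s)) - int (level g) = int (level (walk f s)) - int (level f)"
proof -
  let ?d = "int (level (walk f s)) - int (level f)"
  have s: "s \<in> lists A" "length s \<le> 7 * K + 1" using assms(2) by (auto simp: short_words_def)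
  have "level (walk f s) \<le> level f + length s" by (rule level_walk[OF assms(3) s(1)])
  moreover have "level f \<le> level (walk f s) + length s"
    using level_walk[OF walk_closed[OF assms(3) s(1)] word_inv_closed[OF s(1)]]
      walk_word_inv[OF assms(3) s(1)] by (simp add: length_word_inv)
  ultimately have "(s, ?d) \<in> snd (snd (local_type f))"
    using s assms(2) by (auto simp: local_type_def)
  then show ?thesis unfolding assms(1) by (simp add: local_type_def)
qed

lemma chain_transfer:
  assumes "chain \<F> {e. near (7 * K) f e} p z q" "local_type f = local_type g"
    "s \<in> lists A" "length s \<le> 7 * K" "p = walk f s"
  shows "\<exists>t\<in>lists A. length t \<le> 7 * K \<and> q = walk f t \<and> walk (walk g s) z = walk g t"
  using assms
proof (induction arbitrary: s rule: chain.induct)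
  case (Nil p)
  then show ?case by auto
next
  case (Step M p q y z r)
  from Step.hyps(4) obtain t where t: "t \<in> lists A" "length t \<le> 7 * K" "walk f t = q"
    by (auto simp: near_def)
  have "connects M (walk g s) (walk g t)"
    using local_type_connects[of f g M s t] Step t by (auto simp: short_words_def)
  then have "walk (walk g s) y = walk g t" using Step.hyps by (auto simp: connects_def)
  with Step.IH[of t] Step.prems t show ?case by auto
qed

lemma return_transfer:
  assumes "f \<in> V" "local_type f = local_type g" "z \<in> cone f" "level (walk f z) = level f"
  obtains t where "t \<in> lists A" "length t \<le> 7 * K" "walk f z = walk f t" "walk g z = walk g t"
  using chain_transfer[OF chain_of_return(2)[OF assms(1,3,4)] assms(2), of "[]"] that by auto

text \<open>
  A walk that leaves the cone of \<open>g\<close> does so from a vertex on the level of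
  \<open>g\<close>. By then it has returned to a vertex named by a short word, where the local
  types agree, so it leaves the cone of \<open>f\<close> as well.
\<close>

lemma cone_subset:
  assumes "f \<in> V" "g \<in> V" "local_type f = local_type g"
  shows "cone f \<subseteq> cone g"
proof
  fix z assume "z \<in> cone f"
  then show "z \<in> cone g"
  proof (induction z rule: rev_induct)
    case Nil
    then show ?case by (simp add: cone_def above_Nil)
  next
    case (snoc a z)
    then have z: "z \<in> cone f" "z \<in> cone g" and a: "a \<in> A" "z \<in> lists A"
      by (auto simp: cone_def above_append)
    have "level g \<le> level (walk g (z @ [a]))"
    proof (rule ccontr)
      assume low: "\<not> ?thesis"
      have gz: "walk g z \<in> V" using a assms by (simp add: walk_closed)
      then have "level (walk g z) \<le> Suc (level (walk g (z @ [a])))"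
        using level_walk[OF act_closed[OF gz a(1)], of "[iv a]"] act_iv[OF gz a(1)] iv_closed[OF a(1)] by simp
      moreover have "level g \<le> level (walk g z)" using z by (auto simp: cone_def intro: above_end)
      ultimately have "level (walk g z) = level g" using low by linarith
      from return_transfer[OF assms(2) assms(3)[symmetric] z(2) this] obtain t where
        t: "t \<in> lists A" "length t \<le> 7 * K" "walk g z = walk g t" "walk f z = walk f t" .
      have "t @ [a] \<in> short_words" using t a by (auto simp: short_words_def)
      from local_type_level[OF assms(3) this assms(1)] low t
      have "level (walk f (z @ [a])) < level f" by simp
      moreover have "level f \<le> level (walk f (z @ [a]))"
        using snoc.prems by (auto simp: cone_def dest: above_end)
      ultimately show False by simp
    qed
    then show ?case using z a by (auto simp: cone_def above_append above_Cons above_Nil dest: above_end)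
  qed
qed

text \<open>
  Two words of the cone lead to the same vertex if and only if the first followed by the inverse
  of the second is one of the recorded circuits, so the cone type determines the cone up to
  isomorphism.
\<close>

definition cone_type :: "'v \<Rightarrow> 'a list set \<times> 'a list set" where
  "cone_type f = (cone f, cone f \<inter> circuits f)"

lemma cone_type_local: 
  assumes "f \<in> V" "g \<in> V" "local_type f = local_type g" shows "cone_type f = cone_type g"
proof -
  have "circuits f \<inter> cone f \<subseteq> circuits g" if "f \<in> V" "g \<in> V" "local_type f = local_type g" for f g
  proof
    fix z assume z: "z \<in> circuits f \<inter> cone f"
    then have "level (walk f z) = level f" by (simp add: circuits_def)
    from return_transfer[OF that(1,3) _ this] z obtain t where
      t: "t \<in> lists A" "length t \<le> 7 * K" "walk f z = walk f t" "walk g z = walk g t" by blast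
    have "walk g t = walk g []"
      using that z t by (intro local_type_eq[of f g]) (auto simp: short_words_def circuits_def)
    with t z show "z \<in> circuits g" by (simp add: circuits_def)
  qed
  from this[of f g] this[of g f] show ?thesis
    using assms cone_subset[of f g] cone_subset[of g f] by (auto simp: cone_type_def)
qed

theorem finite_cone_types: "finite (cone_type ` V)"
proof -
  define rep where "rep \<tau> = (SOME f. f \<in> V \<and> local_type f = \<tau>)" for \<tau>
  have "cone_type f = cone_type (rep (local_type f))" if "f \<in> V" for f
    using someI[of "\<lambda>g. g \<in> V \<and> local_type g = local_type f" f] that
    by (intro cone_type_local) (auto simp: rep_def)
  then have "cone_type ` V \<subseteq> (\<lambda>\<tau>. cone_type (rep \<tau>)) ` range local_type" by auto
  then show ?thesis using finite_local_types by (meson finite_imageI finite_subset)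
qed

end

section \<open>Cycles of a word\<close>

abbreviation word_power :: "'a list \<Rightarrow> nat \<Rightarrow> 'a list" where
  "word_power w m \<equiv> concat (replicate m w)"

lemma word_power_add: "word_power w (m + n) = word_power w m @ word_power w n"
  by (simp add: replicate_add)

lemma word_power_lists: "w \<in> lists A \<Longrightarrow> word_power w m \<in> lists A"
  by (induction m) auto

lemma length_word_power: "length (word_power w m) = m * length w"
  by (induction m) auto

text \<open>The factor between the positions \<open>i\<close> and \<open>j\<close> of the infinite word \<open>w w w \<dots>\<close>.\<close>

definition periodic_factor :: "'a list \<Rightarrow> nat \<Rightarrow> nat \<Rightarrow> 'a list" where
  "periodic_factor w i j = map (\<lambda>k. w ! (k mod length w)) [i..<j]"

lemma periodic_factor_append:
  "i \<le> j \<Longrightarrow> j \<le> k \<Longrightarrow> periodic_factor w i j @ periodic_factor w j k = periodic_factor w i k"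
  unfolding periodic_factor_def by (metis le_add_diff_inverse map_append upt_add_eq_append)

lemma length_periodic_factor: "length (periodic_factor w i j) = j - i"
  by (simp add: periodic_factor_def)

lemma periodic_factor_shift:
  assumes "i mod length w = j mod length w"
  shows "periodic_factor w i (i + n) = periodic_factor w j (j + n)"
proof (intro nth_equalityI)
  fix k assume "k < length (periodic_factor w i (i + n))"
  moreover have "(i + k) mod length w = (j + k) mod length w" using assms by (metis mod_add_left_eq)
  ultimately show "periodic_factor w i (i + n) ! k = periodic_factor w j (j + n) ! k"
    by (simp add: periodic_factor_def)
qed (simp add: periodic_factor_def)

lemma periodic_factor_lists: "w \<in> lists A \<Longrightarrow> w \<noteq> [] \<Longrightarrow> periodic_factor w i j \<in> lists A"
  by (auto simp: periodic_factor_def in_lists_conv_set)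

lemma periodic_factor_one: "periodic_factor w 0 (length w) = w"
  by (intro nth_equalityI) (auto simp: periodic_factor_def)

lemma periodic_factor_repeat:
  assumes "n mod length w = 0"
  shows "word_power (periodic_factor w i (i + n)) m = periodic_factor w i (i + m * n)"
proof (induction m)
  case (Suc m)
  have "periodic_factor w i (i + n) @ periodic_factor w (i + n) (i + n + m * n) =
      periodic_factor w i (i + n + m * n)" by (rule periodic_factor_append) auto
  moreover have "periodic_factor w (i + n) (i + n + m * n) = periodic_factor w i (i + m * n)"
    using assms by (intro periodic_factor_shift) (metis add_0_right mod_add_right_eq)
  ultimately show ?case using Suc by (simp add: ac_simps)
qed (simp add: periodic_factor_def)

lemma periodic_factor_power: "periodic_factor w 0 (m * length w) = word_power w m"
  using periodic_factor_repeat[of "length w" w m 0, OF mod_self]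
  unfolding add_0 periodic_factor_one by (rule sym)

context word_action
begin

lemma above_word_inv:
  assumes "v \<in> V" "z \<in> lists A" "above n v z"
  shows "above n (walk v z) (word_inv iv z)"
  using assms
proof (induction z arbitrary: v)
  case Nil
  then show ?case by (simp add: word_inv_def)
next
  case (Cons a z)
  then have a: "a \<in> A" "z \<in> lists A" "act v a \<in> V" by (auto simp: act_closed)
  have inv: "word_inv iv (a # z) = word_inv iv z @ [iv a]" by (simp add: word_inv_def)
  have "above n (act v a) z" "n \<le> level v" using Cons.prems by (auto simp: above_Cons)
  moreover from this have "n \<le> level (act v a)" by (cases z) (auto simp: above_Nil above_Cons)
  ultimately show ?case
    using Cons.IH[of "act v a"] a Cons.prems walk_word_inv[OF a(3,2)]
    by (simp add: inv above_append above_Cons above_Nil act_iv)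
qed

lemma level_prefix_geodesic:
  assumes "u \<in> lists A" "v \<in> lists A" "level (walk x\<^sub>0 (u @ v)) = length (u @ v)"
  shows "level (walk x\<^sub>0 u) = length u"
  using level_walk_root[of u] level_walk[of "walk x\<^sub>0 u" v] assms walk_closed[OF root assms(1)] by simp

lemma circuit_power: "walk p w = p \<Longrightarrow> walk p (word_power w k) = p"
  by (induction k) auto

lemma circuit_power_dvd:
  assumes "walk p (word_power w d) = p" "d dvd n" shows "walk p (word_power w n) = p"
proof -
  have "word_power w (d * k) = word_power (word_power w d) k" for k
    by (induction k) (auto simp: replicate_add)
  then show ?thesis using assms circuit_power by (auto simp: dvd_def)
qed

text \<open>
  The end of \<open>s\<close> has the same cone as its start, so \<open>s\<close> can be read
  again there, and again, always inside the cone of the higher vertex \<open>walk p s\<close>.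
  The level of \<open>p\<close> is never reached again.
\<close>

lemma cone_escape:
  assumes p: "p \<in> V" and s: "s \<in> cone p" and up: "level p < level (walk p s)"
    and same: "cone (walk p s) = cone p" and i: "0 < i"
  shows "walk p (word_power s i) \<noteq> p"
proof -
  have sA: "s \<in> lists A" using s by (simp add: cone_def)
  have cone: "word_power s k \<in> cone p" for k
  proof (induction k)
    case 0
    then show ?case by (simp add: cone_def above_Nil)
  next
    case (Suc k)
    then have "word_power s k \<in> cone (walk p s)" by (simp add: same)
    then have "above (level p) (walk p s) (word_power s k)" "word_power s k \<in> lists A"
      using up by (auto simp: cone_def above_def)
    then show ?case using s by (simp add: cone_def above_append)
  qed
  obtain k where k: "i = Suc k" using i by (cases i) auto
  have "word_power s k \<in> cone (walk p s)" using cone same by simp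
  then have "level (walk p s) \<le> level (walk p (word_power s i))"
    unfolding k cone_def by (auto dest: above_end)
  then show ?thesis using up by auto
qed

end

context context_free_action
begin

text \<open>
  The geodesic from \<open>walk f z\<close> to the root descends to the level of
  \<open>f\<close> after at most \<open>h\<close> steps. Up to that point it stays in the cone,
  so it arrives at a vertex close to \<open>f\<close>.
\<close>

lemma cone_near:
  assumes f: "f \<in> V" and z: "z \<in> cone f" and h: "level (walk f z) \<le> level f + h"
  shows "near (5 * K + h) f (walk f z)"
proof -
  let ?r = "walk f z"
  have zA: "z \<in> lists A" and ab: "above (level f) f z" using z by (auto simp: cone_def)
  have r: "?r \<in> V" using f zA walk_closed by blast
  obtain y where y: "y \<in> lists A" "length y = level ?r" "walk x\<^sub>0 y = ?r" using geodesic[OF r] .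
  define y1 y2 where "y1 = take (level f) y" and "y2 = drop (level f) y"
  have le: "level f \<le> level ?r" using ab by (rule above_end)
  have yy: "y = y1 @ y2" "length y1 = level f" "length y2 \<le> h" "y1 \<in> lists A" "y2 \<in> lists A"
    using y h le by (auto simp: y1_def y2_def min_def dest: in_set_takeD in_set_dropD)
  let ?e = "walk x\<^sub>0 y1"
  have e: "?e \<in> V" "walk ?e y2 = ?r" using yy y root by (auto simp: walk_closed simp flip: foldl_append)
  have "level f \<le> level (walk ?e t)" if "y2 = t @ t'" for t t'
    using level_prefix_geodesic[of "y1 @ t" t'] y yy that by auto
  then have "above (level f) ?e y2" by (auto simp: above_def)
  from above_word_inv[OF e(1) yy(5) this] have "z @ word_inv iv y2 \<in> cone f"
    using z e(2) word_inv_closed[OF yy(5)] by (auto simp: cone_def above_append)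
  moreover have returns: "walk f (z @ word_inv iv y2) = ?e"
    using walk_word_inv[OF e(1) yy(5)] e(2) by simp
  moreover have "level ?e = level f"
    using level_prefix_geodesic[of y1 y2] y yy by auto
  ultimately have "near (5 * K) f ?e" using chain_of_return(1)[OF f] by fastforce
  moreover have "near h ?e ?r" unfolding near_def using yy e by blast
  ultimately show ?thesis by (rule near_trans)
qed

text \<open>
  Pigeonhole principle for the pairs of cone type and position in \<open>w\<close> at the last
  visits to the levels between the lowest one and that of \<open>q j\<close>. After the last
  visit to a level the walk stays above it until time \<open>j\<close>, so the segment between
  two such visits lies in a cone, and two equal pairs contradict \<open>cone_escape\<close>
  because the walk is periodic.
\<close>

lemma orbit_height:
  assumes p: "p \<in> V" and w: "w \<in> lists A" "w \<noteq> []" and m: "0 < m" "walk p (word_power w m) = p"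
    and q: "q = (\<lambda>i. walk p (periodic_factor w 0 i))"
    and low: "\<And>i. level (q i0) \<le> level (q i)"
    and i: "i0 \<le> j"
  shows "level (q j) \<le> level (q i0) + card (cone_type ` V) * length w"
proof (rule ccontr)
  define H where "H = card (cone_type ` V) * length w"
  define f where "f = q i0"
  assume "\<not> ?thesis"
  then have high: "level f + H < level (q j)" by (simp add: f_def H_def)
  have qV: "q i \<in> V" for i using p periodic_factor_lists[OF w] by (simp add: q walk_closed)
  have q_walk: "walk (q a) (periodic_factor w a b) = q b" if "a \<le> b" for a b
    using periodic_factor_append[of 0 a b w] that by (simp add: q flip: foldl_append)
  have period: "q (n + k * (m * length w)) = q n" for n k
  proof -
    have "periodic_factor w 0 (k * (m * length w)) = word_power w (k * m)"
      using periodic_factor_power[of w "k * m"] by (simp add: ac_simps)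
    then have "q (k * (m * length w)) = p" using circuit_power_dvd[OF m(2), of "k * m"] by (simp add: q)
    moreover have "periodic_factor w (k * (m * length w)) (k * (m * length w) + n) = periodic_factor w 0 (0 + n)"
      by (rule periodic_factor_shift) simp
    ultimately show ?thesis
      using q_walk[of "k * (m * length w)" "k * (m * length w) + n"] by (simp add: q add.commute)
  qed
  have step: "level (q (Suc a)) \<le> Suc (level (q a))" for a
    using q_walk[of a "Suc a"] level_walk[OF qV periodic_factor_lists[OF w], of a a "Suc a"]
    by (simp add: length_periodic_factor)
  \<comment> \<open>the last visit to level \<open>level f + h\<close> up to time \<open>j\<close>, on exactly that level by \<open>t_level\<close>\<close>
  define t where "t h = Max {a. i0 \<le> a \<and> a \<le> j \<and> level (q a) \<le> level f + h}" for h
  have t: "i0 \<le> t h" "t h \<le> j" "level (q (t h)) \<le> level f + h" for h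
    using Max_in[of "{a. i0 \<le> a \<and> a \<le> j \<and> level (q a) \<le> level f + h}"] i
    by (fastforce simp: t_def f_def)+
  have t_max: "a \<le> t h" if "i0 \<le> a" "a \<le> j" "level (q a) \<le> level f + h" for a h
    unfolding t_def using that by (intro Max_ge) auto
  have after: "level f + h < level (q a)" if "t h < a" "a \<le> j" for a h
    using t_max[of a h] t(1)[of h] that by fastforce
  have t_level: "level (q (t h)) = level f + h" if "h \<le> H" for h
  proof -
    have "t h \<noteq> j" using t(3)[of h] high that by auto
    then have "t h < j" using t(2)[of h] by simp
    with after[of h "Suc (t h)"] step[of "t h"] t(3)[of h] show ?thesis by simp
  qed
  let ?g = "\<lambda>h. (cone_type (q (t h)), t h mod length w)"
  have "\<not> inj_on ?g {..H}"
  proof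
    assume "inj_on ?g {..H}"
    moreover have "?g ` {..H} \<subseteq> cone_type ` V \<times> {..<length w}" using qV w(2) by auto
    ultimately have "card {..H} \<le> card (cone_type ` V \<times> {..<length w})"
      using finite_cone_types by (intro card_inj_on_le) auto
    then show False by (simp add: H_def card_cartesian_product)
  qed
  then obtain h h' where h: "h < h'" "h' \<le> H" "?g h = ?g h'"
    unfolding inj_on_def by (metis atMost_iff linorder_neqE_nat)
  define s where "s = periodic_factor w (t h) (t h')"
  have "t h \<le> t h'" using t_max[of "t h" h'] t[of h] h by simp
  then obtain n where n: "t h' = t h + n" using le_Suc_ex by blast
  have n0: "n mod length w = 0"
    using h(3) n by (metis Pair_inject add_diff_cancel_left' mod_eq_dvd_iff_nat \<open>t h \<le> t h'\<close> dvd_imp_mod_0)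
  have walk_s: "walk (q (t h)) s = q (t h')" using \<open>t h \<le> t h'\<close> by (simp add: s_def q_walk)
  have "s \<in> cone (q (t h))"
    unfolding cone_def above_def
  proof (intro CollectI conjI allI impI)
    show "s \<in> lists A" unfolding s_def by (rule periodic_factor_lists[OF w])
    fix s1 s2 assume split: "s = s1 @ s2"
    have "length s1 \<le> n" using split n by (metis add_diff_cancel_left' length_append le_add1 length_periodic_factor s_def)
    have "s1 = take (length s1) s" using split by simp
    also have "\<dots> = periodic_factor w (t h) (t h + length s1)"
      using \<open>length s1 \<le> n\<close> n by (simp add: s_def periodic_factor_def take_map)
    finally have s1: "walk (q (t h)) s1 = q (t h + length s1)" using q_walk[of "t h" "t h + length s1"] by simp
    show "level (q (t h)) \<le> level (walk (q (t h)) s1)"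
    proof (cases "length s1 = 0")
      case False
      with after[of h "t h + length s1"] \<open>length s1 \<le> n\<close> n t(2)[of h'] t(3)[of h] show ?thesis
        unfolding s1 by simp
    qed simp
  qed
  moreover have "level (q (t h)) < level (walk (q (t h)) s)"
    using t_level[of h] t_level[of h'] h walk_s by simp
  moreover have "cone (walk (q (t h)) s) = cone (q (t h))"
    using h(3) walk_s by (simp add: cone_type_def)
  moreover have "0 < m * length w" using m w by simp
  ultimately have "walk (q (t h)) (word_power s (m * length w)) \<noteq> q (t h)"
    using cone_escape[OF qV] by blast
  moreover have "word_power s (m * length w) = periodic_factor w (t h) (t h + m * length w * n)"
    unfolding s_def n using periodic_factor_repeat[OF n0] by blast
  ultimately show False
    using q_walk[of "t h" "t h + m * length w * n"] period[of "t h" n] by (simp add: ac_simps)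
qed

lemma card_near: "finite {e. near n f e}" "card {e. near n f e} \<le> (1 + card A) ^ n"
proof -
  let ?W = "{s. set s \<subseteq> A \<and> length s \<le> n}"
  have eq: "{e. near n f e} = walk f ` ?W" by (auto simp: near_def lists_eq_set)
  have fin: "finite ?W" using finite_lists_length_le[OF finite_A] .
  then show "finite {e. near n f e}" by (simp add: eq)
  have "(\<Sum>i\<le>n. card A ^ i) \<le> (1 + card A) ^ n"
  proof (induction n)
    case (Suc n)
    have "card A ^ n \<le> (1 + card A) ^ n" by (intro power_mono) auto
    then have "card A ^ Suc n \<le> card A * (1 + card A) ^ n" by simp
    from add_mono[OF Suc this] show ?case by simp
  qed simp
  moreover have "card ?W = (\<Sum>i\<le>n. card A ^ i)" by (rule card_lists_length_le[OF finite_A])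
  ultimately show "card {e. near n f e} \<le> (1 + card A) ^ n"
    unfolding eq using card_image_le[OF fin, of "walk f"] by simp
qed

text \<open>
  A finite cycle lies in a ball around its lowest vertex whose radius is linear in the length of
  \<open>w\<close>, so its length is at most exponential and divides the factorial. The constant
  depends neither on the vertex nor on \<open>w\<close>.
\<close>

lemma finite_orbit_exponent:
  "\<exists>c. \<forall>p\<in>V. \<forall>w\<in>lists A. (\<exists>m>0. walk p (word_power w m) = p) \<longrightarrow>
    walk p (word_power w (fact (c ^ Suc (length w)))) = p"
proof -
  define T where "T = card (cone_type ` V)"
  define c where "c = (1 + card A) ^ (5 * K + T)"
  have main: "walk p (word_power w (fact (c ^ Suc (length w)))) = p"
    if p: "p \<in> V" and w: "w \<in> lists A" and m: "0 < m" "walk p (word_power w m) = p" for p w m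
  proof (cases "w = []")
    case True
    then show ?thesis by simp
  next
    case w0: False
    define q where "q = (\<lambda>i. walk p (periodic_factor w 0 i))"
    obtain i0 where low: "\<And>i. level (q i0) \<le> level (q i)"
      using ex_has_least_nat[of "\<lambda>_. True" 0 "\<lambda>i. level (q i)"] by auto
    define f where "f = q i0"
    define n where "n = 5 * K + T * length w"
    have fV: "f \<in> V" using p periodic_factor_lists[OF w w0] by (simp add: f_def q_def walk_closed)
    have near_late: "near n f (q j)" if "i0 \<le> j" for j
    proof -
      define z where "z = periodic_factor w i0 j"
      have walk_z: "walk f (periodic_factor w i0 k) = q k" if "i0 \<le> k" for k
        using periodic_factor_append[of 0 i0 k w] that by (simp add: f_def q_def flip: foldl_append)
      have "z \<in> cone f"
        unfolding cone_def above_def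
      proof (intro CollectI conjI allI impI)
        show "z \<in> lists A" unfolding z_def by (rule periodic_factor_lists[OF w w0])
        fix z1 z2 assume split: "z = z1 @ z2"
        have "length z1 \<le> j - i0" using split by (metis length_append le_add1 length_periodic_factor z_def)
        moreover have "z1 = take (length z1) z" using split by simp
        ultimately have "z1 = periodic_factor w i0 (i0 + length z1)"
          using that by (simp add: z_def periodic_factor_def take_map)
        then have "walk f z1 = q (i0 + length z1)" using walk_z[of "i0 + length z1"] by simp
        then show "level f \<le> level (walk f z1)" using low by (simp add: f_def)
      qed
      moreover have "walk f z = q j" unfolding z_def by (rule walk_z[OF that])
      moreover have "level (q j) \<le> level f + T * length w"
        unfolding f_def T_def by (rule orbit_height[OF p w w0 m q_def low that])
      ultimately show ?thesis using cone_near[OF fV] unfolding n_def by metis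
    qed
    have q_power: "q (k * length w) = walk p (word_power w k)" for k
      by (simp add: q_def periodic_factor_power)
    have near_all: "near n f (walk p (word_power w k))" for k
    proof -
      have "1 \<le> m" "1 \<le> length w" using m w0 by (auto simp: Suc_le_eq)
      then have "i0 * 1 * 1 \<le> i0 * m * length w" by (intro mult_mono) auto
      also have "\<dots> \<le> (m * i0 + k) * length w" by (simp add: algebra_simps)
      finally have "i0 \<le> (m * i0 + k) * length w" by simp
      have "walk p (word_power w (m * i0)) = p" by (rule circuit_power_dvd[OF m(2)]) simp
      then have "walk p (word_power w (m * i0 + k)) = walk p (word_power w k)"
        unfolding word_power_add by simp
      then show ?thesis using near_late[OF \<open>i0 \<le> _\<close>] q_power by metis
    qed
    define N where "N = (1 + card A) ^ n"
    have "\<not> inj_on (\<lambda>k. walk p (word_power w k)) {..N}"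
    proof
      assume "inj_on (\<lambda>k. walk p (word_power w k)) {..N}"
      then have "card {..N} \<le> card {e. near n f e}"
        using near_all card_near(1) by (intro card_inj_on_le[of "\<lambda>k. walk p (word_power w k)"]) auto
      then show False using card_near(2)[of n f] by (simp add: N_def)
    qed
    then obtain a b where ab: "a < b" "b \<le> N" "walk p (word_power w a) = walk p (word_power w b)"
      unfolding inj_on_def by (metis atMost_iff linorder_neqE_nat)
    have "walk (walk p (word_power w (b - a))) (word_power w a) = walk p (word_power w a)"
      using word_power_add[of "b - a" a w] ab by (simp flip: foldl_append)
    then have "walk p (word_power w (b - a)) = p"
      using p w walk_cancel walk_closed word_power_lists by metis
    moreover have "n \<le> (5 * K + T) * Suc (length w)" by (simp add: n_def algebra_simps)
    then have "N \<le> c ^ Suc (length w)"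
      unfolding N_def c_def by (subst power_mult[symmetric]) (rule power_increasing, auto)
    then have "b - a dvd fact (c ^ Suc (length w))" using ab by (intro dvd_fact) auto
    ultimately show ?thesis by (rule circuit_power_dvd)
  qed
  then show ?thesis by blast
qed

text \<open>
  Let \<open>f\<close> be the lowest vertex on the walk along \<open>w = w1 w2\<close> from
  \<open>p\<close>, reached after \<open>w1\<close>. Read from \<open>f\<close>, the inverse of
  \<open>w1\<close> and \<open>w2\<close> both belong to the cone, and the walk from
  \<open>p\<close> is closed if and only if they lead to the same vertex. This is visible at a
  representative \<open>g\<close> of the cone type, near the root.
\<close>

lemma trivial_in_ball:
  "\<exists>R. \<forall>w\<in>lists A. (\<forall>u\<in>lists A. length u \<le> R + length w \<longrightarrow> walk (walk x\<^sub>0 u) w = walk x\<^sub>0 u) \<longrightarrow>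
    (\<forall>p\<in>V. walk p w = p)"
proof -
  define rep where "rep \<tau> = (SOME g. g \<in> V \<and> cone_type g = \<tau>)" for \<tau>
  define R where "R = Max (insert 0 (level ` rep ` cone_type ` V))"
  have rep: "rep (cone_type f) \<in> V" "cone_type (rep (cone_type f)) = cone_type f" "level (rep (cone_type f)) \<le> R"
    if "f \<in> V" for f
  proof -
    show "rep (cone_type f) \<in> V" "cone_type (rep (cone_type f)) = cone_type f"
      using someI[of "\<lambda>g. g \<in> V \<and> cone_type g = cone_type f" f] that by (auto simp: rep_def)
    show "level (rep (cone_type f)) \<le> R"
      unfolding R_def using finite_cone_types that by (intro Max_ge) auto
  qed
  have "walk p w = p" if w: "w \<in> lists A" and p: "p \<in> V"
    and ball: "\<And>u. u \<in> lists A \<Longrightarrow> length u \<le> R + length w \<Longrightarrow> walk (walk x\<^sub>0 u) w = walk x\<^sub>0 u" for w p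
  proof -
    obtain i where i: "i \<le> length w"
      and low: "\<And>j. j \<le> length w \<Longrightarrow> level (walk p (take i w)) \<le> level (walk p (take j w))"
      using ex_has_least_nat[of "\<lambda>i. i \<le> length w" 0 "\<lambda>i. level (walk p (take i w))"] by auto
    define w1 w2 f where "w1 = take i w" and "w2 = drop i w" and "f = walk p w1"
    have ww: "w = w1 @ w2" "w1 \<in> lists A" "w2 \<in> lists A"
      using w by (auto simp: w1_def w2_def dest: in_set_takeD in_set_dropD)
    have f: "f \<in> V" using p ww by (simp add: f_def walk_closed)
    have "above (level f) p w"
      unfolding above_def
    proof (intro allI impI)
      fix u v assume "w = u @ v"
      then show "level f \<le> level (walk p u)"
        using low[of "length u"] by (simp add: f_def w1_def)
    qed
    then have "above (level f) p (w1 @ w2)" unfolding ww(1)[symmetric] .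
    then have ab: "above (level f) p w1" "above (level f) f w2" by (auto simp: above_append f_def)
    define z where "z = word_inv iv w1"
    have zA: "z \<in> lists A" unfolding z_def by (rule word_inv_closed[OF ww(2)])
    have zf: "z \<in> cone f" "w2 \<in> cone f"
      using above_word_inv[OF p ww(2) ab(1)] ab(2) zA ww by (auto simp: cone_def z_def f_def)
    have pz: "walk f z = p" unfolding f_def z_def by (rule walk_word_inv[OF p ww(2)])
    define g where "g = rep (cone_type f)"
    have g: "g \<in> V" "cone_type g = cone_type f" "level g \<le> R" using rep[OF f] by (auto simp: g_def)
    then have cones: "cone g = cone f" "cone g \<inter> circuits g = cone f \<inter> circuits f"
      by (auto simp: cone_type_def)
    obtain u where u: "u \<in> lists A" "length u = level g" "walk x\<^sub>0 u = g" using geodesic[OF g(1)] .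
    have returns: "word_inv iv z = w1"
      using ww(2) by (auto simp: z_def word_inv_def rev_map iv_iv comp_def in_lists_conv_set intro: map_idI)
    have gz: "walk (walk g z) w1 = g" using walk_word_inv[OF g(1) zA] returns by simp
    have "walk (walk x\<^sub>0 (u @ z)) w = walk x\<^sub>0 (u @ z)"
      using u zA g(3) ww(1) by (intro ball) (auto simp: z_def length_word_inv)
    then have loop: "walk g w2 = walk g z" using u ww(1) gz by simp
    have "z \<in> cone g" "w2 \<in> cone g" using zf cones(1) by auto
    then have "above (level g) g z" "above (level g) g w2" by (auto simp: cone_def)
    then have "w2 @ w1 \<in> cone g"
      using above_word_inv[OF g(1) zA] returns loop ww(2,3) by (simp add: cone_def above_append)
    moreover have "walk g (w2 @ w1) = g" using loop gz by simp
    then have "w2 @ w1 \<in> circuits g" using ww by (auto simp: circuits_def)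
    ultimately have "w2 @ w1 \<in> circuits f" using cones(2) by blast
    then have "walk (walk f w2) w1 = walk p w1" by (simp add: circuits_def f_def)
    then have "walk f w2 = p"
      using walk_cancel[of "walk f w2" p w1] f p ww(2,3) by (simp add: walk_closed)
    then show ?thesis using ww(1) by (simp add: f_def)
  qed
  then show ?thesis by blast
qed

text \<open>
  Exponent and range of conjugators are computable from the length of \<open>w\<close>:
  \<open>c\<close> and \<open>R\<close> are constants of the action.
\<close>

theorem finite_order_criterion:
  "\<exists>c R. \<forall>w\<in>lists A.
    (\<exists>m>0. \<forall>p\<in>V. walk p (word_power w m) = p) \<longleftrightarrow>
    (\<forall>u\<in>lists A. length u \<le> R + fact (c ^ Suc (length w)) * length w \<longrightarrow>
      u @ word_power w (fact (c ^ Suc (length w))) @ word_inv iv u \<in> circuits x\<^sub>0)"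
proof -
  obtain c where c: "\<And>p w m. p \<in> V \<Longrightarrow> w \<in> lists A \<Longrightarrow> 0 < m \<Longrightarrow> walk p (word_power w m) = p \<Longrightarrow>
      walk p (word_power w (fact (c ^ Suc (length w)))) = p"
    using finite_orbit_exponent by blast
  obtain R where R: "\<And>w p. w \<in> lists A \<Longrightarrow>
      (\<And>u. u \<in> lists A \<Longrightarrow> length u \<le> R + length w \<Longrightarrow> walk (walk x\<^sub>0 u) w = walk x\<^sub>0 u) \<Longrightarrow>
      p \<in> V \<Longrightarrow> walk p w = p"
    using trivial_in_ball by blast
  have conj: "u @ v @ word_inv iv u \<in> circuits x\<^sub>0 \<longleftrightarrow> walk p v = p"
    if u: "u \<in> lists A" and v: "v \<in> lists A" and p: "walk x\<^sub>0 u = p" for u v p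
  proof -
    have V1: "p \<in> V" using walk_closed[OF root u] p by simp
    note V = V1 walk_closed[OF V1 v]
    have inv: "walk p (word_inv iv u) = x\<^sub>0" using walk_word_inv[OF root u] p by simp
    have "u @ v @ word_inv iv u \<in> lists A" using u v word_inv_closed[OF u] by simp
    then have "u @ v @ word_inv iv u \<in> circuits x\<^sub>0 \<longleftrightarrow> walk (walk p v) (word_inv iv u) = x\<^sub>0"
      using p by (simp add: circuits_def)
    also have "\<dots> \<longleftrightarrow> walk p v = p"
      using walk_cancel[OF V(2,1) word_inv_closed[OF u]] inv by metis
    finally show ?thesis .
  qed
  show ?thesis
  proof (rule exI[of _ c], rule exI[of _ R], intro ballI iffI impI)
    fix w u assume w: "w \<in> lists A" and u: "u \<in> lists A"
      and "\<exists>m>0. \<forall>p\<in>V. walk p (word_power w m) = p"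
    then obtain m where "0 < m" "\<And>p. p \<in> V \<Longrightarrow> walk p (word_power w m) = p" by blast
    with c[OF _ w] have "walk p (word_power w (fact (c ^ Suc (length w)))) = p" if "p \<in> V" for p
      using that by blast
    then show "u @ word_power w (fact (c ^ Suc (length w))) @ word_inv iv u \<in> circuits x\<^sub>0"
      using conj[OF u word_power_lists[OF w] refl] walk_closed[OF root u] by blast
  next
    fix w assume w: "w \<in> lists A" and ball: "\<forall>u\<in>lists A.
      length u \<le> R + fact (c ^ Suc (length w)) * length w \<longrightarrow>
      u @ word_power w (fact (c ^ Suc (length w))) @ word_inv iv u \<in> circuits x\<^sub>0"
    let ?W = "word_power w (fact (c ^ Suc (length w)))"
    have W: "?W \<in> lists A" by (rule word_power_lists[OF w])
    have "walk (walk x\<^sub>0 u) ?W = walk x\<^sub>0 u" if "u \<in> lists A" "length u \<le> R + length ?W" for u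
      using ball that conj[OF that(1) W refl] unfolding length_word_power by blast
    from R[OF W this] have "walk p ?W = p" if "p \<in> V" for p using that by blast
    then show "\<exists>m>0. \<forall>p\<in>V. walk p (word_power w m) = p"
      by (intro exI[of _ "fact (c ^ Suc (length w))"]) auto
  qed
qed

end

section \<open>Deciding the criterion\<close>

lemma decidable_wordsI:
  assumes "\<And>code :: 'a \<Rightarrow> nat. inj_on code A \<Longrightarrow>
    \<exists>P. decidable 1 (\<lambda>xs. P (list_decode (xs ! 0))) \<and> (\<forall>w\<in>lists A. P (map code w) \<longleftrightarrow> w \<in> L)"
  shows "decidable_words A L"
  unfolding decidable_words_def
proof (intro allI impI)
  fix code :: "'a \<Rightarrow> nat" assume "inj_on code A"
  from assms[OF this] obtain P where P: "decidable 1 (\<lambda>xs. P (list_decode (xs ! 0)))"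
    "\<And>w. w \<in> lists A \<Longrightarrow> P (map code w) \<longleftrightarrow> w \<in> L" by blast
  from P(1) obtain f where f: "\<And>xs. length xs = 1 \<Longrightarrow>
      rec_eval f xs (if P (list_decode (xs ! 0)) then 1 else 0)"
    unfolding decidable_def computable_def by blast
  show "\<exists>f. \<forall>w\<in>lists A. rec_eval f [list_encode (map code w)] (if w \<in> L then 1 else 0)"
  proof (intro exI[of _ f] ballI)
    fix w assume "w \<in> lists A"
    then show "rec_eval f [list_encode (map code w)] (if w \<in> L then 1 else 0)"
      using f[of "[list_encode (map code w)]"] P(2)[of w] by simp
  qed
qed

lemma splitting_family_image:
  assumes "splitting_family \<F>"
  shows "splitting_family ((\<lambda>M. map g ` (M \<inter> lists A)) ` \<F>)"
  unfolding splitting_family_def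
proof (intro conjI ballI impI)
  let ?h = "\<lambda>M. map g ` (M \<inter> lists A)"
  show "finite (?h ` \<F>)" using assms by (simp add: splitting_family_def)
  fix N w assume N: "N \<in> ?h ` \<F>" "w \<in> N" "2 \<le> length w"
  then obtain M v where M: "M \<in> \<F>" "N = ?h M" and v: "v \<in> M" "v \<in> lists A" "w = map g v" by auto
  with N have "2 \<le> length v" by simp
  from splitting_familyE[OF assms M(1) v(1) this] obtain P Q s t where
    PQ: "P \<in> \<F>" "Q \<in> \<F>" "s \<in> P" "t \<in> Q" "s \<noteq> []" "t \<noteq> []" "v = s @ t"
      "\<And>x y. x \<in> P \<Longrightarrow> y \<in> Q \<Longrightarrow> x @ y \<in> M" by blast
  have prod: "p @ q \<in> N" if "p \<in> ?h P" "q \<in> ?h Q" for p q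
  proof -
    from that obtain p' q' where "p' \<in> P \<inter> lists A" "q' \<in> Q \<inter> lists A"
      "p = map g p'" "q = map g q'" by blast
    then show ?thesis unfolding M(2) using PQ(8)
      by (intro image_eqI[of _ _ "p' @ q'"]) auto
  qed
  have "map g s \<in> ?h P" "map g t \<in> ?h Q" "?h P \<in> ?h ` \<F>" "?h Q \<in> ?h ` \<F>"
    "map g s \<noteq> []" "map g t \<noteq> []" "w = map g s @ map g t"
    using PQ v by auto
  then show "\<exists>P\<in>?h ` \<F>. \<exists>Q\<in>?h ` \<F>. \<exists>u\<in>P. \<exists>v\<in>Q. u \<noteq> [] \<and> v \<noteq> [] \<and> w = u @ v \<and>
      (\<forall>p\<in>P. \<forall>q\<in>Q. p @ q \<in> N)"
    by (intro bexI[of _ "?h P"] bexI[of _ "?h Q"] bexI[of _ "map g s"] bexI[of _ "map g t"] conjI ballI prod)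
qed

lemma list_encode_le_replicate:
  "set u \<subseteq> {..<m} \<Longrightarrow> length u \<le> b \<Longrightarrow> list_encode u \<le> list_encode (replicate b m)"
proof (induction b arbitrary: u)
  case (Suc b)
  have tri: "i \<le> j \<Longrightarrow> triangle i \<le> triangle j" for i j
    by (induction rule: dec_induct) auto
  have mono: "prod_encode (a, x) \<le> prod_encode (a', x')" if "a \<le> a'" "x \<le> x'" for a a' x x'
    using that tri[of "a + x" "a' + x'"] by (simp add: prod_encode_def)
  show ?case
  proof (cases u)
    case (Cons a u')
    with Suc show ?thesis using mono[of a m "list_encode u'" "list_encode (replicate b m)"] by simp
  qed simp
qed simp

text \<open>
  The right-hand side is that of \<open>finite_order_criterion\<close> for the word
  \<open>v\<close> obtained from \<open>w\<close> by the substitution \<open>h\<close>. The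
  letters of \<open>A\<close> are numbered from \<open>0\<close> to \<open>m - 1\<close>, and
  the words \<open>u\<close> are searched among the lists with codes up to that of a constant
  list with entry \<open>m\<close>, which dominates every list of admissible length.
\<close>

lemma conjugate_powers_decidable:
  fixes h :: "'b \<Rightarrow> 'a list" and code :: "'b \<Rightarrow> nat"
  assumes sf: "splitting_family \<F>" "L \<in> \<F>" and A: "finite A" and iv: "\<And>a. a \<in> A \<Longrightarrow> iv a \<in> A"
    and Y: "finite Y" "inj_on code Y" and h: "\<And>y. y \<in> Y \<Longrightarrow> h y \<in> lists A"
  shows "\<exists>P. decidable 1 (\<lambda>xs. P (list_decode (xs ! 0))) \<and>
    (\<forall>w\<in>lists Y. P (map code w) \<longleftrightarrow>
      (let v = concat (map h w); N = fact (c ^ Suc (length v)) in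
        \<forall>u\<in>lists A. length u \<le> R + N * length v \<longrightarrow> u @ word_power v N @ word_inv iv u \<in> L))"
proof -
  define m where "m = card A"
  obtain g where "bij_betw g A {0..<m}" using ex_bij_betw_finite_nat[OF A] m_def by blast
  then have g: "bij_betw g A {..<m}" by (simp add: lessThan_atLeast0)
  then have inj: "inj_on g A" and gA: "g ` A = {..<m}" by (auto simp: bij_betw_def)
  define M where "M = map g ` (L \<inter> lists A)"
  have M: "decidable n (\<lambda>xs. F xs \<in> M)" if "computable_list n F" for n F
  proof -
    have "decidable 1 (\<lambda>xs. list_decode (xs ! 0) \<in> M)"
    proof (rule splitting_family_decidable[OF splitting_family_image[OF sf(1), of g A]])
      show "M \<in> (\<lambda>M. map g ` (M \<inter> lists A)) ` \<F>" using sf(2) by (auto simp: M_def)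
      show "\<Union>((\<lambda>M. map g ` (M \<inter> lists A)) ` \<F>) \<subseteq> lists {..<m}" using gA by fastforce
    qed simp
    from computable_compose1[OF this[unfolded decidable_def], of n "\<lambda>xs. list_encode (F xs)"] that
    show ?thesis by (simp add: decidable_def computable_list_def)
  qed
  have mem_M: "map g v \<in> M \<longleftrightarrow> v \<in> L" if "v \<in> lists A" for v
  proof
    assume "map g v \<in> M"
    then obtain v' where "v' \<in> L" "v' \<in> lists A" "map g v = map g v'" by (auto simp: M_def)
    moreover have "inj_on g (set v \<union> set v')" using that \<open>v' \<in> lists A\<close> by (intro inj_on_subset[OF inj]) auto
    ultimately show "v \<in> L" by (simp add: inj_on_map_eq_map)
  qed (use that in \<open>auto simp: M_def\<close>)
  \<comment> \<open>the two homomorphisms on codes of letters\<close>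
  define H where "H n = map g (h (the_inv_into Y code n))" for n
  define I where "I n = [g (iv (the_inv_into A g n))]" for n
  define V where "V l = concat (map (\<lambda>a. if a \<in> code ` Y then H a else []) l)" for l
  define J where "J l = concat (map (\<lambda>a. if a \<in> {..<m} then I a else []) (rev l))" for l
  define N where "N l = (fact (c ^ Suc (length (V l))) :: nat)" for l
  define B where "B l = R + N l * length (V l)" for l
  define P where "P l \<longleftrightarrow> (\<forall>k < Suc (list_encode (replicate (B l) m)).
      set (list_decode k) \<subseteq> {..<m} \<and> length (list_decode k) \<le> B l \<longrightarrow>
      list_decode k @ word_power (V l) (N l) @ J (list_decode k) \<in> M)" for l
  have V: "V (map code w) = map g (concat (map h w))" if "w \<in> lists Y" for w
    using that by (induction w) (auto simp: V_def H_def the_inv_into_f_f[OF Y(2)])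
  have J: "J (map g u) = map g (word_inv iv u)" if "u \<in> lists A" for u
    using that gA
    by (induction u) (auto simp: J_def I_def word_inv_def the_inv_into_f_f[OF inj])
  have comp_V: "computable_list n (\<lambda>xs. V (F xs))" if "computable_list n F" for n F
    unfolding V_def using Y(1) that by (intro computable_list_hom) auto
  have comp_J: "computable_list n (\<lambda>xs. J (F xs))" if "computable_list n F" for n F
    unfolding J_def using that by (intro computable_list_anti_hom) auto
  have dec: "decidable 1 (\<lambda>xs. P (list_decode (xs ! 0)))"
    unfolding P_def B_def N_def by (intro computable_intros M comp_V comp_J) auto
  have "P (map code w) \<longleftrightarrow> (let v = concat (map h w); N = fact (c ^ Suc (length v)) in
        \<forall>u\<in>lists A. length u \<le> R + N * length v \<longrightarrow> u @ word_power v N @ word_inv iv u \<in> L)"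
    if w: "w \<in> lists Y" for w
  proof -
    define v where "v = concat (map h w)"
    define K where "K = (fact (c ^ Suc (length v)) :: nat)"
    have v: "v \<in> lists A" using w h unfolding v_def by (induction w) auto
    have Vw: "V (map code w) = map g v" by (simp add: V[OF w] v_def)
    have Nw: "N (map code w) = K" by (simp add: N_def Vw K_def)
    have Bw: "B (map code w) = R + K * length v" by (simp add: B_def Vw Nw)
    have W: "word_power (map g v) K = map g (word_power v K)" by (simp add: map_concat)
    have inL: "map g u @ word_power (map g v) K @ J (map g u) \<in> M \<longleftrightarrow>
        u @ word_power v K @ word_inv iv u \<in> L" if u: "u \<in> lists A" for u
    proof -
      have "word_inv iv u \<in> lists A" using u iv by (auto simp: word_inv_def)
      then have "u @ word_power v K @ word_inv iv u \<in> lists A"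
        using u word_power_lists[OF v] by simp
      from mem_M[OF this] show ?thesis unfolding W J[OF u] by simp
    qed
    have "P (map code w) \<longleftrightarrow> (\<forall>u\<in>lists A. length u \<le> R + K * length v \<longrightarrow>
        map g u @ word_power (map g v) K @ J (map g u) \<in> M)"
      unfolding P_def Bw Nw Vw
    proof (intro iffI ballI allI impI)
      fix u assume all: "\<forall>k<Suc (list_encode (replicate (R + K * length v) m)).
          set (list_decode k) \<subseteq> {..<m} \<and> length (list_decode k) \<le> R + K * length v \<longrightarrow>
          list_decode k @ word_power (map g v) K @ J (list_decode k) \<in> M"
        and u: "u \<in> lists A" "length u \<le> R + K * length v"
      have s: "set (map g u) \<subseteq> {..<m}" using u gA by auto
      with u list_encode_le_replicate[of "map g u" m "R + K * length v"]
      show "map g u @ word_power (map g v) K @ J (map g u) \<in> M"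
        using all[rule_format, of "list_encode (map g u)"] by simp
    next
      fix k assume all: "\<forall>u\<in>lists A. length u \<le> R + K * length v \<longrightarrow>
          map g u @ word_power (map g v) K @ J (map g u) \<in> M"
        and k: "set (list_decode k) \<subseteq> {..<m} \<and> length (list_decode k) \<le> R + K * length v"
      have "list_decode k \<in> lists (g ` A)" using k gA by auto
      then obtain u where u: "u \<in> lists A" "list_decode k = map g u" unfolding lists_image by blast
      then show "list_decode k @ word_power (map g v) K @ J (list_decode k) \<in> M"
        using all k by auto
    qed
    also have "\<dots> \<longleftrightarrow> (\<forall>u\<in>lists A. length u \<le> R + K * length v \<longrightarrow> u @ word_power v K @ word_inv iv u \<in> L)"
      using inL by blast
    finally show ?thesis by (simp add: Let_def v_def K_def)
  qed
  with dec show ?thesis by blast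
qed

section \<open>Transition groups\<close>

context complete_A_graph
begin

definition step where
  "step v a = tgt \<Gamma> (THE e. e \<in> edges \<Gamma> \<and> src \<Gamma> e = v \<and> label \<Gamma> e = a)"

lemma step_arc: "e \<in> edges \<Gamma> \<Longrightarrow> step (src \<Gamma> e) (label \<Gamma> e) = tgt \<Gamma> e"
proof -
  assume e: "e \<in> edges \<Gamma>"
  then have "(THE e'. e' \<in> edges \<Gamma> \<and> src \<Gamma> e' = src \<Gamma> e \<and> label \<Gamma> e' = label \<Gamma> e) = e"
    by (intro the_equality) (auto intro: deterministic)
  then show ?thesis by (simp add: step_def)
qed

lemma awalk_step:
  assumes "pre_digraph.awalk (dgraph \<Gamma>) u p v"
  shows "map (label \<Gamma>) p \<in> lists A" "foldl step u (map (label \<Gamma>) p) = v"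
proof -
  interpret wf_digraph "dgraph \<Gamma>" by (rule wf)
  have "map (label \<Gamma>) p \<in> lists A \<and> foldl step u (map (label \<Gamma>) p) = v"
    using assms by (induction p arbitrary: u) (auto simp: awalk_Cons_iff awalk_Nil_iff label_closed step_arc)
  then show "map (label \<Gamma>) p \<in> lists A" "foldl step u (map (label \<Gamma>) p) = v" by auto
qed

lemma circuit_language_step:
  assumes "x \<in> vertices \<Gamma>"
  shows "circuit_language \<Gamma> x = {w \<in> lists A. foldl step x w = x}"
proof (intro equalityI subsetI)
  fix w assume "w \<in> circuit_language \<Gamma> x"
  then show "w \<in> {w \<in> lists A. foldl step x w = x}"
    using awalk_step unfolding circuit_language_def by blast
next
  fix w assume "w \<in> {w \<in> lists A. foldl step x w = x}"
  then have w: "w \<in> lists A" "foldl step x w = x" by auto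
  from ex_awalk[OF w(1) assms] obtain p v where p: "pre_digraph.awalk (dgraph \<Gamma>) x p v" "map (label \<Gamma>) p = w"
    by blast
  with awalk_step(2)[OF p(1)] w have "v = x" by simp
  with p show "w \<in> circuit_language \<Gamma> x"
    unfolding circuit_language_def by blast
qed

lemma word_action_step:
  assumes "x\<^sub>0 \<in> vertices \<Gamma>" shows "word_action A iv (vertices \<Gamma>) step x\<^sub>0"
proof -
  interpret wf_digraph "dgraph \<Gamma>" by (rule wf)
  show ?thesis
  proof unfold_locales
    fix v a assume "v \<in> vertices \<Gamma>" "a \<in> A"
    then obtain e where e: "e \<in> edges \<Gamma>" "src \<Gamma> e = v" "label \<Gamma> e = a" using complete by blast
    then show "step v a \<in> vertices \<Gamma>" using step_arc[OF e(1)] by auto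
    show "step (step v a) (iv a) = v"
      using step_arc[OF e(1)] step_arc[OF arc_inv_closed[OF e(1)]] e
      by (simp add: src_arc_inv tgt_arc_inv label_arc_inv)
  next
    fix v assume v: "v \<in> vertices \<Gamma>"
    have "symmetric (dgraph \<Gamma>)"
      unfolding symmetric_conv using arc_inv_closed src_arc_inv tgt_arc_inv by (metis (no_types))
    from symmetric_connected_imp_strongly_connected[OF this connected]
    have "x\<^sub>0 \<rightarrow>\<^sup>*\<^bsub>dgraph \<Gamma>\<^esub> v" using assms v by (auto simp: strongly_connected_def)
    then obtain p where "awalk x\<^sub>0 p v" unfolding reachable_awalk by blast
    from awalk_step[OF this] show "\<exists>u\<in>lists A. foldl step x\<^sub>0 u = v" by blast
  qed (rule assms)
qed

end

lemma (in word_action) walk_reduce: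
  assumes "v \<in> V" "w \<in> lists A" shows "walk v (reduce iv w) = walk v w"
proof -
  have push: "walk v (push iv a u) = walk (act v a) u" if "v \<in> V" "a \<in> A" for v a u
    using that by (cases u) (auto simp: act_iv)
  show ?thesis
    using assms by (induction w arbitrary: v) (auto simp: reduce_def push act_closed)
qed

locale transition_family = involutive_alphabet A iv
  for A :: "'a set" and iv :: "'a \<Rightarrow> 'a" +
  fixes \<Gamma>s :: "('v, 'e, 'a) labelled_graph list"
  assumes complete_graphs: "\<Gamma> \<in> set \<Gamma>s \<Longrightarrow> complete_A_graph A iv \<Gamma>"
begin

abbreviation "F \<equiv> free_group A iv"
abbreviation "T \<equiv> transition_group A iv \<Gamma>s"
abbreviation "element \<equiv> word_element A iv \<Gamma>s"

lemma normal_kernel: "transition_kernel A iv \<Gamma>s \<lhd> F"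
  by (rule normal_transition_kernel[OF involutive_alphabet_axioms complete_graphs])

lemma group_T: "group T"
  by (rule group_transition_group[OF involutive_alphabet_axioms complete_graphs])

lemma kernel_words_iff:
  "w \<in> kernel_words A \<Gamma>s \<longleftrightarrow> w \<in> lists A \<and>
    (\<forall>\<Gamma>\<in>set \<Gamma>s. \<forall>p\<in>vertices \<Gamma>. foldl (complete_A_graph.step \<Gamma>) p w = p)"
  using complete_A_graph.circuit_language_step[OF complete_graphs]
  by (auto simp: kernel_words_def)

text \<open>
  Free reduction does not change the action, so membership in the kernel, a set of reduced
  words, can be tested on arbitrary words.
\<close>

lemma kernel_words_reduce:
  assumes "w \<in> lists A"
  shows "reduce iv w \<in> kernel_words A \<Gamma>s \<longleftrightarrow> w \<in> kernel_words A \<Gamma>s"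
proof -
  have "foldl (complete_A_graph.step \<Gamma>) p (reduce iv w) = foldl (complete_A_graph.step \<Gamma>) p w"
    if "\<Gamma> \<in> set \<Gamma>s" "p \<in> vertices \<Gamma>" for \<Gamma> p
    using word_action.walk_reduce[OF complete_A_graph.word_action_step[OF complete_graphs] _ assms] that
    by blast
  then show ?thesis using assms reduce_closed[OF assms, of iv] by (simp add: kernel_words_iff)
qed

lemma reduce_in_carrier: "w \<in> lists A \<Longrightarrow> reduce iv w \<in> carrier F"
  using reduce_closed[of w A iv] by (simp add: free_group_def reduced_reduce)

lemma element_closed: "w \<in> lists A \<Longrightarrow> element w \<in> carrier T"
  unfolding word_element_def transition_group_def carrier_FactGroup using reduce_in_carrier by blast

lemma element_surj: assumes "x \<in> carrier T" obtains w where "w \<in> lists A" "x = element w"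
proof -
  from assms obtain w where "w \<in> carrier F" "x = transition_kernel A iv \<Gamma>s #>\<^bsub>F\<^esub> w"
    unfolding transition_group_def carrier_FactGroup by blast
  then show thesis using that[of w] by (simp add: free_group_def word_element_def reduce_reduced)
qed

lemma element_append:
  assumes "u \<in> lists A" "v \<in> lists A" shows "element (u @ v) = element u \<otimes>\<^bsub>T\<^esub> element v"
proof -
  have "reduce iv u \<otimes>\<^bsub>F\<^esub> reduce iv v = reduce iv (u @ v)"
    using assms by (simp add: free_group_def reduce_append_reduce_left reduce_append_reduce_right)
  then show ?thesis
    using normal.rcos_sum[OF normal_kernel reduce_in_carrier[OF assms(1)] reduce_in_carrier[OF assms(2)]]
    by (simp add: word_element_def transition_group_def)
qed

lemma element_eq_one:
  assumes "w \<in> lists A" shows "element w = \<one>\<^bsub>T\<^esub> \<longleftrightarrow> w \<in> kernel_words A \<Gamma>s"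
proof -
  interpret N: normal "transition_kernel A iv \<Gamma>s" F by (rule normal_kernel)
  have "element w = \<one>\<^bsub>T\<^esub> \<longleftrightarrow> reduce iv w \<in> transition_kernel A iv \<Gamma>s"
    using N.coset_join1[OF _ reduce_in_carrier[OF assms] N.subgroup_axioms]
      N.coset_join2[OF reduce_in_carrier[OF assms] N.subgroup_axioms]
    by (auto simp: word_element_def transition_group_def)
  also have "\<dots> \<longleftrightarrow> w \<in> kernel_words A \<Gamma>s"
  proof
    assume "reduce iv w \<in> transition_kernel A iv \<Gamma>s"
    then obtain k where k: "k \<in> kernel_words A \<Gamma>s" "reduce iv w = reduce iv k"
      by (auto simp: transition_kernel_def)
    moreover have "k \<in> lists A" using k by (simp add: kernel_words_def)
    ultimately show "w \<in> kernel_words A \<Gamma>s" using kernel_words_reduce assms by metis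
  qed (auto simp: transition_kernel_def)
  finally show ?thesis .
qed

lemma element_Nil: "element [] = \<one>\<^bsub>T\<^esub>"
  by (subst element_eq_one) (auto simp: kernel_words_iff)

lemma element_power: "w \<in> lists A \<Longrightarrow> element w [^]\<^bsub>T\<^esub> n = element (word_power w n)"
proof (induction n)
  case 0
  then show ?case by (simp add: element_Nil)
next
  case (Suc n)
  have "word_power w (Suc n) = word_power w n @ w"
    using word_power_add[of n 1 w] by simp
  with Suc show ?case using element_append[OF word_power_lists] by simp
qed

text \<open>
  Each graph contributes its own exponent; their product serves for all graphs at once.
\<close>

lemma finite_order_element:
  assumes w: "w \<in> lists A"
  shows "finite_order T (element w) \<longleftrightarrow> (\<forall>\<Gamma>\<in>set \<Gamma>s.
    \<exists>m>0. \<forall>p\<in>vertices \<Gamma>. foldl (complete_A_graph.step \<Gamma>) p (word_power w m) = p)"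
proof -
  have "finite_order T (element w) \<longleftrightarrow> (\<exists>m>0. word_power w m \<in> kernel_words A \<Gamma>s)"
    unfolding finite_order_def group.ord_eq_0[OF group_T element_closed[OF w]] element_power[OF w]
      element_eq_one[OF word_power_lists[OF w]] by auto
  also have "\<dots> \<longleftrightarrow> (\<forall>\<Gamma>\<in>set \<Gamma>s. \<exists>m>0. \<forall>p\<in>vertices \<Gamma>.
      foldl (complete_A_graph.step \<Gamma>) p (word_power w m) = p)" (is "?l \<longleftrightarrow> (\<forall>\<Gamma>\<in>set \<Gamma>s. \<exists>m>0. ?P \<Gamma> m)")
  proof
    assume ?l
    then show "\<forall>\<Gamma>\<in>set \<Gamma>s. \<exists>m>0. ?P \<Gamma> m" unfolding kernel_words_iff by blast
  next
    assume "\<forall>\<Gamma>\<in>set \<Gamma>s. \<exists>m>0. ?P \<Gamma> m"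
    then obtain m where m: "\<And>\<Gamma>. \<Gamma> \<in> set \<Gamma>s \<Longrightarrow> 0 < m \<Gamma>" "\<And>\<Gamma>. \<Gamma> \<in> set \<Gamma>s \<Longrightarrow> ?P \<Gamma> (m \<Gamma>)" by metis
    define n where "n = (\<Prod>\<Gamma>\<in>set \<Gamma>s. m \<Gamma>)"
    have "?P \<Gamma> n" if \<Gamma>: "\<Gamma> \<in> set \<Gamma>s" for \<Gamma>
    proof
      fix p assume p: "p \<in> vertices \<Gamma>"
      interpret complete_A_graph A iv \<Gamma> by (rule complete_graphs[OF \<Gamma>])
      interpret word_action A iv "vertices \<Gamma>" step p by (rule word_action_step[OF p])
      have "m \<Gamma> dvd n" unfolding n_def using \<Gamma> by (intro dvd_prodI) auto
      with circuit_power_dvd m(2)[OF \<Gamma>] p show "walk p (word_power w n) = p" by blast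
    qed
    moreover have "0 < n" unfolding n_def using m(1) by (intro prod_pos) auto
    ultimately show ?l using word_power_lists[OF w] unfolding kernel_words_iff by blast
  qed
  finally show ?thesis .
qed

text \<open>
  The substitution \<open>h\<close> covers at once words over \<open>A\<close> itself and words
  in the generators of an isomorphic group.
\<close>

theorem torsion_decidable:
  fixes h :: "'b \<Rightarrow> 'a list"
  assumes cf: "\<And>\<Gamma>. \<Gamma> \<in> set \<Gamma>s \<Longrightarrow> context_free_graph \<Gamma>"
    and Y: "finite Y" and h: "\<And>y. y \<in> Y \<Longrightarrow> h y \<in> lists A"
  shows "decidable_words Y {w. finite_order T (element (concat (map h w)))}"
proof (rule decidable_wordsI)
  fix code :: "'b \<Rightarrow> nat" assume code: "inj_on code Y"
  have "\<exists>P. decidable 1 (\<lambda>xs. P (list_decode (xs ! 0))) \<and> (\<forall>w\<in>lists Y. P (map code w) \<longleftrightarrow>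
      (\<exists>m>0. \<forall>p\<in>vertices \<Gamma>. foldl (complete_A_graph.step \<Gamma>) p (word_power (concat (map h w)) m) = p))"
    if \<Gamma>: "\<Gamma> \<in> set \<Gamma>s" for \<Gamma>
  proof -
    interpret complete_A_graph A iv \<Gamma> by (rule complete_graphs[OF \<Gamma>])
    obtain x\<^sub>0 where x0: "x\<^sub>0 \<in> vertices \<Gamma>" "context_free_language (circuit_language \<Gamma> x\<^sub>0)"
      using cf[OF \<Gamma>] by (auto simp: context_free_graph_def)
    interpret word_action A iv "vertices \<Gamma>" step x\<^sub>0 by (rule word_action_step[OF x0(1)])
    obtain \<F> where \<F>: "splitting_family \<F>" "circuit_language \<Gamma> x\<^sub>0 \<in> \<F>"
      by (rule context_free_splitting_family[OF x0(2)])
    have L: "circuit_language \<Gamma> x\<^sub>0 = circuits x\<^sub>0"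
      unfolding circuits_def by (rule circuit_language_step[OF x0(1)])
    define K where "K = Max (insert 0 ((\<lambda>M. length (SOME w. w \<in> M)) ` \<F>))"
    interpret context_free_action A iv "vertices \<Gamma>" step x\<^sub>0 \<F> K
    proof unfold_locales
      fix M assume "M \<in> \<F>" "M \<noteq> {}"
      moreover have "finite \<F>" using \<F>(1) by (simp add: splitting_family_def)
      ultimately have "(SOME w. w \<in> M) \<in> M" "length (SOME w. w \<in> M) \<le> K"
        unfolding K_def by (auto simp: some_in_eq intro!: Max_ge)
      then show "\<exists>w\<in>M. length w \<le> K" by blast
    qed (use \<F> L in auto)
    obtain c R where crit: "\<And>w. w \<in> lists A \<Longrightarrow>
        (\<exists>m>0. \<forall>p\<in>vertices \<Gamma>. walk p (word_power w m) = p) \<longleftrightarrow>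
        (\<forall>u\<in>lists A. length u \<le> R + fact (c ^ Suc (length w)) * length w \<longrightarrow>
          u @ word_power w (fact (c ^ Suc (length w))) @ word_inv iv u \<in> circuits x\<^sub>0)"
      using finite_order_criterion by blast
    obtain P where P: "decidable 1 (\<lambda>xs. P (list_decode (xs ! 0)))"
      "\<forall>w\<in>lists Y. P (map code w) \<longleftrightarrow>
      (let v = concat (map h w); N = fact (c ^ Suc (length v)) in
        \<forall>u\<in>lists A. length u \<le> R + N * length v \<longrightarrow> u @ word_power v N @ word_inv iv u \<in> circuits x\<^sub>0)"
      using conjugate_powers_decidable[where h = h and iv = iv and c = c and R = R,
          OF splitting circuits_root finite_A iv_closed Y code h]
      by blast
    have "concat (map h w) \<in> lists A" if "w \<in> lists Y" for w
      using that h by (induction w) auto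
    with P crit show ?thesis by (intro exI[of _ P]) (simp add: Let_def)
  qed
  then obtain P where P: "\<And>\<Gamma>. \<Gamma> \<in> set \<Gamma>s \<Longrightarrow> decidable 1 (\<lambda>xs. P \<Gamma> (list_decode (xs ! 0)))"
    "\<And>\<Gamma> w. \<Gamma> \<in> set \<Gamma>s \<Longrightarrow> w \<in> lists Y \<Longrightarrow> P \<Gamma> (map code w) \<longleftrightarrow>
      (\<exists>m>0. \<forall>p\<in>vertices \<Gamma>. foldl (complete_A_graph.step \<Gamma>) p (word_power (concat (map h w)) m) = p)"
    by metis
  have "concat (map h w) \<in> lists A" if "w \<in> lists Y" for w
    using that h by (induction w) auto
  with P(2) have "(\<forall>\<Gamma>\<in>set \<Gamma>s. P \<Gamma> (map code w)) \<longleftrightarrow> finite_order T (element (concat (map h w)))"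
    if "w \<in> lists Y" for w
    using that by (simp add: finite_order_element)
  moreover have "decidable 1 (\<lambda>xs. \<forall>\<Gamma>\<in>set \<Gamma>s. P \<Gamma> (list_decode (xs ! 0)))"
    by (rule decidable_finite_all) (use P in auto)
  ultimately show "\<exists>P. decidable 1 (\<lambda>xs. P (list_decode (xs ! 0))) \<and>
      (\<forall>w\<in>lists Y. P (map code w) \<longleftrightarrow> w \<in> {w. finite_order T (element (concat (map h w)))})"
    by (intro exI[of _ "\<lambda>l. \<forall>\<Gamma>\<in>set \<Gamma>s. P \<Gamma> l"]) simp
qed

end

lemma finite_order_iso:
  assumes "group G" "group H" "\<phi> \<in> iso G H" "x \<in> carrier G"
  shows "finite_order G x \<longleftrightarrow> finite_order H (\<phi> x)"
proof -
  interpret G: group G by fact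
  interpret H: group H by fact
  interpret group_hom G H \<phi> using assms(3) by unfold_locales (auto simp: iso_def)
  have "x [^]\<^bsub>G\<^esub> n = \<one>\<^bsub>G\<^esub> \<longleftrightarrow> \<phi> x [^]\<^bsub>H\<^esub> n = \<one>\<^bsub>H\<^esub>" for n :: nat
    using assms(3,4) inj_on_one_iff hom_nat_pow[OF assms(4), of n] hom_one
    by (metis (no_types, lifting) G.nat_pow_closed bij_betw_imp_inj_on iso_def mem_Collect_eq)
  then show ?thesis
    using assms(4) by (simp add: finite_order_def G.ord_eq_0 H.ord_eq_0)
qed

text \<open>
  Words in generators of \<open>G\<close> are translated letter by letter into words over
  \<open>A\<close>. The preimages of the letters generate \<open>G\<close>, so finite generating
  sets exist.
\<close>

theorem (in transition_family) torsion_problem_solvable_iso: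
  fixes G :: "'g monoid"
  assumes cf: "\<And>\<Gamma>. \<Gamma> \<in> set \<Gamma>s \<Longrightarrow> context_free_graph \<Gamma>" and G: "group G" and iso: "G \<cong> T"
  shows "torsion_problem_solvable G"
proof -
  obtain \<phi> where \<phi>: "\<phi> \<in> iso G T" using iso by (auto simp: is_iso_def)
  interpret G: group G by fact
  interpret T: group T by (rule group_T)
  interpret group_hom G T \<phi> using \<phi> by unfold_locales (auto simp: iso_def)
  have bij: "inj_on \<phi> (carrier G)" "\<phi> ` carrier G = carrier T"
    using \<phi> by (auto simp: iso_def bij_betw_def)
  define X where "X = {x \<in> carrier G. \<exists>a\<in>A. \<phi> x = element [a]}"
  have "finite (\<phi> ` X)"
    by (rule finite_subset[of _ "(\<lambda>a. element [a]) ` A"]) (auto simp: X_def finite_A)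
  then have X: "finite X" "X \<subseteq> carrier G"
    using inj_on_subset[OF bij(1), of X] by (auto simp: X_def dest: finite_imageD)
  have gen: "x \<in> generate G X" if "w \<in> lists A" "x \<in> carrier G" "\<phi> x = element w" for w x
    using that
  proof (induction w arbitrary: x)
    case Nil
    then have "x = \<one>\<^bsub>G\<^esub>" using inj_onD[OF bij(1), of x "\<one>\<^bsub>G\<^esub>"] by (simp add: element_Nil)
    then show ?case by (simp add: generate.one)
  next
    case (Cons a w)
    then have a: "[a] \<in> lists A" "w \<in> lists A" by auto
    obtain y where y: "y \<in> carrier G" "\<phi> y = element [a]" using element_closed[OF a(1)] bij(2) by (metis imageE)
    obtain z where z: "z \<in> carrier G" "\<phi> z = element w" using element_closed[OF a(2)] bij(2) by (metis imageE)
    have "\<phi> (y \<otimes>\<^bsub>G\<^esub> z) = \<phi> x" using y z Cons.prems element_append[OF a] by simp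
    then have "y \<otimes>\<^bsub>G\<^esub> z = x" using inj_onD[OF bij(1)] y z Cons.prems by blast
    moreover have "y \<in> X" using y a by (auto simp: X_def)
    ultimately show ?case using Cons.IH[OF z] generate.incl generate.eng by metis
  qed
  have "carrier G \<subseteq> generate G X"
  proof
    fix x assume x: "x \<in> carrier G"
    from element_surj[OF hom_closed[OF this]] obtain w where "w \<in> lists A" "\<phi> x = element w" .
    then show "x \<in> generate G X" using gen x by blast
  qed
  then have "generate G X = carrier G" using G.generate_incl[OF X(2)] by blast
  moreover have "decidable_words (X \<union> m_inv G ` X) {w. finite_order G (word_value G w)}"
    if X: "finite X" "X \<subseteq> carrier G" for X
  proof -
    define Y where "Y = X \<union> m_inv G ` X"
    define h where "h y = (SOME w. w \<in> lists A \<and> \<phi> y = element w)" for y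
    have Y: "finite Y" "Y \<subseteq> carrier G" using X by (auto simp: Y_def)
    have h: "h y \<in> lists A" "\<phi> y = element (h y)" if "y \<in> Y" for y
    proof -
      have "y \<in> carrier G" using that Y by blast
      from element_surj[OF hom_closed[OF this]] obtain w where "w \<in> lists A" "\<phi> y = element w" .
      then have "w \<in> lists A \<and> \<phi> y = element w" by simp
      from someI[of "\<lambda>w. w \<in> lists A \<and> \<phi> y = element w", OF this, folded h_def]
      show "h y \<in> lists A" "\<phi> y = element (h y)" by auto
    qed
    have val: "word_value G w \<in> carrier G \<and> concat (map h w) \<in> lists A \<and>
        \<phi> (word_value G w) = element (concat (map h w))" if "w \<in> lists Y" for w
      using that
    proof (induction w)
      case (Cons y w)
      then have "y \<in> Y" "y \<in> carrier G" using Y by auto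
      with Cons h[OF \<open>y \<in> Y\<close>] show ?case
        using element_append[of "h y" "concat (map h w)"] by (simp add: word_value_def)
    qed (simp add: word_value_def element_Nil)
    have "w \<in> {w. finite_order G (word_value G w)} \<longleftrightarrow> w \<in> {w. finite_order T (element (concat (map h w)))}"
      if "w \<in> lists Y" for w
      using finite_order_iso[OF G group_T \<phi>] val[OF that] by auto
    with torsion_decidable[OF cf Y(1) h(1)] show ?thesis
      unfolding decidable_words_def Y_def by (simp cong: ball_cong)
  qed
  ultimately show ?thesis
    unfolding torsion_problem_solvable_def using X by blast
qed

theorem theorem5p10:
  fixes A :: "'a set" and iv :: "'a \<Rightarrow> 'a"
    and \<Gamma>s :: "('v, 'e, 'a) labelled_graph list"
  assumes "involutive_alphabet A iv"
    and "\<Gamma>s \<noteq> []"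
    and "\<forall>\<Gamma> \<in> set \<Gamma>s. complete_A_graph A iv \<Gamma> \<and> context_free_graph \<Gamma>"
  shows "decidable_words A
           {w. finite_order (transition_group A iv \<Gamma>s) (word_element A iv \<Gamma>s w)} \<and>
         (\<forall>G :: 'g monoid. group G \<longrightarrow> G \<cong> transition_group A iv \<Gamma>s \<longrightarrow>
            torsion_problem_solvable G)"
proof -
  interpret involutive_alphabet A iv by fact
  interpret transition_family A iv \<Gamma>s
    using assms by (intro transition_family.intro transition_family_axioms.intro) auto
  have cf: "\<And>\<Gamma>. \<Gamma> \<in> set \<Gamma>s \<Longrightarrow> context_free_graph \<Gamma>" using assms(3) by blast
  have "decidable_words A {w. finite_order T (element (concat (map (\<lambda>a. [a]) w)))}"
    by (rule torsion_decidable[OF cf finite_A]) auto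
  moreover have "torsion_problem_solvable G" if "group G" "G \<cong> T" for G :: "'g monoid"
    by (rule torsion_problem_solvable_iso[OF cf that])
  ultimately show ?thesis by simp
qed

end
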